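(* Let $\Gamma$ be a labelled graph representing a Coxeter matrix over a finite set, and suppose that the Artin group $A_\Gamma$ is even and of FC type. Then $A_\Gamma$ is residually finite.
   Context: Let $S$ be a finite set. A Coxeter matrix over $S$ is a matrix $M=(m_{s,t})_{s,t\in S}$ with coefficients in $\mathbb N\cup\{\infty\}$ such that $m_{s,s}=1$ for all $s$, and $m_{s,t}=m_{t,s}\ge 2$ for $s\ne t$. It is represented by a labelled graph $\Gamma$ with vertex set $V(\Gamma)=S$, where distinct $s,t$ are joined by an edge labelled $m_{s,t}$ exactly when $m_{s,t}\neq\infty$. For $m\ge 2$ let $\Pi(a,b:m)$ be the alternating word $aba\cdots$ of length $m$. The Artin group is $A_\Gamma=\langle S\mid \Pi(s,t:m_{s,t})=\Pi(t,s:m_{s,t})$ for all $s\neq t$ with $m_{s,t}\ne\infty\rangle$, and the Coxeter group $W_\Gamma$ is the quotient of $A_\Gamma$ by the relations $s^2=1$, $s\in S$. For $T\subset S$, $\Gamma_T$ is the full labelled subgraph spanned by $T$, and $A_T$ is the subgroup of $A_\Gamma$ generated by $T$ (it is the Artin group of $\Gamma_T$ by van der Lek). $A_\Gamma$ is of spherical type if $W_\Gamma$ is finite. $A_\Gamma$ is of FC type if $A_T$ is of spherical type (i.e. $W_{\Gamma_T}$ is finite) for every $T\subset S$ such that $m_{s,t}\neq\infty$ for all $s,t\in T$. $A_\Gamma$ is even if $m_{s,t}$ is even for all distinct $s,t\in S$ ($\infty$ counts as even). A group $G$ is residually finite if for every $g\in G\setminus\{1\}$ there is a normal subgroup of finite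 index in $G$ not containing $g$. *)

theory Defs
  imports "HOL-Algebra.Coset" "HOL-Library.Extended_Nat"
begin

section \<open>Groups given by generators and relations\<close>

text \<open>A letter \<open>(s, True)\<close> stands for the generator \<open>s\<close>, and \<open>(s, False)\<close> for its formal
  inverse. A relation \<open>x = y\<close> is a pair of words \<open>(x, y)\<close>.\<close>

type_synonym 'a word = "('a \<times> bool) list"

definition words :: "'a set \<Rightarrow> 'a word set" where
  "words S = lists (S \<times> UNIV)"

inductive_set word_eq :: "'a set \<Rightarrow> ('a word \<times> 'a word) set \<Rightarrow> ('a word \<times> 'a word) set"
  for S :: "'a set" and R :: "('a word \<times> 'a word) set" where
  refl: "u \<in> words S \<Longrightarrow> (u, u) \<in> word_eq S R"
| sym: "(u, v) \<in> word_eq S R \<Longrightarrow> (v, u) \<in> word_eq S R"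
| trans: "(u, v) \<in> word_eq S R \<Longrightarrow> (v, w) \<in> word_eq S R \<Longrightarrow> (u, w) \<in> word_eq S R"
| cancel: "s \<in> S \<Longrightarrow> u \<in> words S \<Longrightarrow> v \<in> words S
    \<Longrightarrow> (u @ [(s, b), (s, \<not> b)] @ v, u @ v) \<in> word_eq S R"
| rel: "(x, y) \<in> R \<Longrightarrow> x \<in> words S \<Longrightarrow> y \<in> words S \<Longrightarrow> u \<in> words S \<Longrightarrow> v \<in> words S
    \<Longrightarrow> (u @ x @ v, u @ y @ v) \<in> word_eq S R"

text \<open>The group \<open>\<langle>S | R\<rangle>\<close>; its elements are classes of words over \<open>S\<close>. Pairs in \<open>R\<close> that are
  not words over \<open>S\<close> play no role.\<close>

definition presented_group ::
    "'a set \<Rightarrow> ('a word \<times> 'a word) set \<Rightarrow> 'a word set monoid" where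
  "presented_group S R =
     \<lparr>carrier = words S // word_eq S R,
      mult = (\<lambda>A B. \<Union>u\<in>A. \<Union>v\<in>B. word_eq S R `` {u @ v}),
      one = word_eq S R `` {[]}\<rparr>"

lemma words_simps [simp]:
  "[] \<in> words S"
  "a # u \<in> words S \<longleftrightarrow> fst a \<in> S \<and> u \<in> words S"
  "u @ v \<in> words S \<longleftrightarrow> u \<in> words S \<and> v \<in> words S"
  by (auto simp: words_def mem_Times_iff)

lemma word_eq_words: "(u, v) \<in> word_eq S R \<Longrightarrow> u \<in> words S \<and> v \<in> words S"
  by (induction rule: word_eq.induct) auto

lemma equiv_word_eq: "equiv (words S) (word_eq S R)"
proof (rule equivI)
  show "word_eq S R \<subseteq> words S \<times> words S"
    using word_eq_words by fastforce
  show "refl_on (words S) (word_eq S R)"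
    by (simp add: refl_on_def word_eq.refl)
  show "sym (word_eq S R)"
    by (auto intro: symI word_eq.sym)
  show "trans (word_eq S R)"
    by (auto intro: transI word_eq.trans)
qed

lemma word_eq_context:
  assumes "(u, v) \<in> word_eq S R" "a \<in> words S" "b \<in> words S"
  shows "(a @ u @ b, a @ v @ b) \<in> word_eq S R"
  using assms
proof (induction rule: word_eq.induct)
  case (cancel s u v c)
  then show ?case
    using word_eq.cancel[of s S "a @ u" "v @ b" c R] by simp
next
  case (rel x y u v)
  then show ?case
    using word_eq.rel[of x y R S "a @ u" "v @ b"] by simp
qed (auto intro: word_eq.refl word_eq.sym word_eq.trans)

lemma word_eq_append:
  assumes "(u, u') \<in> word_eq S R" "(v, v') \<in> word_eq S R"
  shows "(u @ v, u' @ v') \<in> word_eq S R"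
  using word_eq_context[OF assms(1), of "[]" v] word_eq_context[OF assms(2), of u' "[]"]
    word_eq_words[OF assms(1)] word_eq_words[OF assms(2)]
  by (auto intro: word_eq.trans)

lemma mult_presented_group:
  assumes "u \<in> words S" "v \<in> words S"
  shows "word_eq S R `` {u} \<otimes>\<^bsub>presented_group S R\<^esub> word_eq S R `` {v} = word_eq S R `` {u @ v}"
proof -
  have "(\<lambda>u v. word_eq S R `` {u @ v}) respects2 word_eq S R"
    by (rule congruent2I', rule equiv_class_eq[OF equiv_word_eq], rule word_eq_append)
  from UN_equiv_class2[OF equiv_word_eq equiv_word_eq this assms] show ?thesis
    by (simp add: presented_group_def)
qed

lemma word_eq_inverse:
  "u \<in> words S \<Longrightarrow> (rev (map (\<lambda>(s, b). (s, \<not> b)) u) @ u, []) \<in> word_eq S R \<and>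
     rev (map (\<lambda>(s, b). (s, \<not> b)) u) \<in> words S"
proof (induction u)
  case (Cons a u)
  obtain s b where a: "a = (s, b)" by force
  let ?i = "rev (map (\<lambda>(s, b). (s, \<not> b)) u)"
  have "(?i @ [(s, \<not> b), (s, \<not> \<not> b)] @ u, ?i @ u) \<in> word_eq S R"
    by (rule word_eq.cancel) (use Cons a in auto)
  with Cons a show ?case by (auto intro: word_eq.trans)
qed (auto intro: word_eq.refl)

lemma group_presented_group: "group (presented_group S R)"
proof (rule groupI)
  have carr: "\<exists>u\<in>words S. x = word_eq S R `` {u}" if "x \<in> carrier (presented_group S R)" for x
    using that by (auto simp: presented_group_def quotient_def)
  have cls: "word_eq S R `` {u} \<in> carrier (presented_group S R)" if "u \<in> words S" for u
    using that by (simp add: presented_group_def quotientI)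
  have one: "\<one>\<^bsub>presented_group S R\<^esub> = word_eq S R `` {[]}"
    by (simp add: presented_group_def)
  show "\<one>\<^bsub>presented_group S R\<^esub> \<in> carrier (presented_group S R)"
    by (simp add: one cls)
  show "x \<otimes>\<^bsub>presented_group S R\<^esub> y \<in> carrier (presented_group S R)"
    if "x \<in> carrier (presented_group S R)" "y \<in> carrier (presented_group S R)" for x y
    using carr[OF that(1)] carr[OF that(2)] by (auto simp: mult_presented_group cls)
  show "x \<otimes>\<^bsub>presented_group S R\<^esub> y \<otimes>\<^bsub>presented_group S R\<^esub> z
      = x \<otimes>\<^bsub>presented_group S R\<^esub> (y \<otimes>\<^bsub>presented_group S R\<^esub> z)"
    if "x \<in> carrier (presented_group S R)" "y \<in> carrier (presented_group S R)"
      "z \<in> carrier (presented_group S R)" for x y z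
    using carr[OF that(1)] carr[OF that(2)] carr[OF that(3)] by (auto simp: mult_presented_group)
  show "\<one>\<^bsub>presented_group S R\<^esub> \<otimes>\<^bsub>presented_group S R\<^esub> x = x"
    if "x \<in> carrier (presented_group S R)" for x
    using carr[OF that] by (auto simp: mult_presented_group one)
  show "\<exists>y\<in>carrier (presented_group S R). y \<otimes>\<^bsub>presented_group S R\<^esub> x = \<one>\<^bsub>presented_group S R\<^esub>"
    if "x \<in> carrier (presented_group S R)" for x
  proof -
    from carr[OF that] obtain u where u: "u \<in> words S" "x = word_eq S R `` {u}" by blast
    let ?i = "rev (map (\<lambda>(s, b). (s, \<not> b)) u)"
    have "word_eq S R `` {?i @ u} = word_eq S R `` {[]}"
      by (rule equiv_class_eq[OF equiv_word_eq]) (use word_eq_inverse[OF u(1)] in blast)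
    then show ?thesis
      using u word_eq_inverse[OF u(1), of R]
      by (intro bexI[of _ "word_eq S R `` {?i}"]) (auto simp: mult_presented_group one cls)
  qed
qed

section \<open>Artin groups and Coxeter groups\<close>

text \<open>The labelled graph \<open>\<Gamma>\<close> is given by its vertex set \<open>S\<close> and its labels \<open>M\<close>; distinct \<open>s\<close>, \<open>t\<close>
  are joined by an edge iff \<open>M s t \<noteq> \<infinity>\<close>. Only the values of \<open>M\<close> on \<open>S \<times> S\<close> matter, so the
  full labelled subgraph spanned by \<open>T \<subseteq> S\<close> is given by \<open>T\<close> and the same \<open>M\<close>.\<close>

definition coxeter_matrix :: "'a set \<Rightarrow> ('a \<Rightarrow> 'a \<Rightarrow> enat) \<Rightarrow> bool" where
  "coxeter_matrix S M \<longleftrightarrow>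
     (\<forall>s\<in>S. M s s = 1) \<and>
     (\<forall>s\<in>S. \<forall>t\<in>S. s \<noteq> t \<longrightarrow> M s t = M t s \<and> M s t \<ge> 2)"

fun alt_word :: "'a \<Rightarrow> 'a \<Rightarrow> nat \<Rightarrow> 'a word" where
  "alt_word a b 0 = []"
| "alt_word a b (Suc m) = (a, True) # alt_word b a m"

definition artin_relations :: "'a set \<Rightarrow> ('a \<Rightarrow> 'a \<Rightarrow> enat) \<Rightarrow> ('a word \<times> 'a word) set" where
  "artin_relations S M =
     {(alt_word s t m, alt_word t s m) | s t m. s \<in> S \<and> t \<in> S \<and> s \<noteq> t \<and> M s t = enat m}"

definition artin_group :: "'a set \<Rightarrow> ('a \<Rightarrow> 'a \<Rightarrow> enat) \<Rightarrow> 'a word set monoid" where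
  "artin_group S M = presented_group S (artin_relations S M)"

definition coxeter_group :: "'a set \<Rightarrow> ('a \<Rightarrow> 'a \<Rightarrow> enat) \<Rightarrow> 'a word set monoid" where
  "coxeter_group S M =
     presented_group S (artin_relations S M \<union> {([(s, True), (s, True)], []) | s. s \<in> S})"

definition spherical_type :: "'a set \<Rightarrow> ('a \<Rightarrow> 'a \<Rightarrow> enat) \<Rightarrow> bool" where
  "spherical_type S M \<longleftrightarrow> finite (carrier (coxeter_group S M))"

definition FC_type :: "'a set \<Rightarrow> ('a \<Rightarrow> 'a \<Rightarrow> enat) \<Rightarrow> bool" where
  "FC_type S M \<longleftrightarrow>
     (\<forall>T\<subseteq>S. (\<forall>s\<in>T. \<forall>t\<in>T. M s t \<noteq> \<infinity>) \<longrightarrow> spherical_type T M)"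

text \<open>The label \<open>\<infinity>\<close> counts as even.\<close>

definition even_type :: "'a set \<Rightarrow> ('a \<Rightarrow> 'a \<Rightarrow> enat) \<Rightarrow> bool" where
  "even_type S M \<longleftrightarrow>
     (\<forall>s\<in>S. \<forall>t\<in>S. s \<noteq> t \<longrightarrow> (\<forall>m. M s t = enat m \<longrightarrow> even m))"

definition residually_finite :: "('g, 'h) monoid_scheme \<Rightarrow> bool" where
  "residually_finite G \<longleftrightarrow>
     (\<forall>g\<in>carrier G - {\<one>\<^bsub>G\<^esub>}. \<exists>N. N \<lhd> G \<and> finite (rcosets\<^bsub>G\<^esub> N) \<and> g \<notin> N)"

end

theory Submission
  imports Defs "HOL-Algebra.Elementary_Groups" "HOL-Combinatorics.Permutations" Complex_Main
begin

text \<open>Killing the generators outside \<open>T \<subseteq> S\<close> respects even braid relations, so \<open>A\<^sub>T\<close> is a retract of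
  \<open>A\<^sub>S\<close>. If \<open>m\<^sub>s\<^sub>t = \<infinity>\<close>, then \<open>A\<^sub>S\<close> is the amalgam of \<open>A\<close> over \<open>S - {s}\<close> and over \<open>S - {t}\<close> along
  their common retract, and residual finiteness passes to it (Boler and Evans): a finite quotient
  \<open>F\<close> of \<open>A\<^sub>S\<close> to which both retractions descend yields an action of \<open>A\<^sub>S\<close> on the finite set of
  reduced words of bounded length in the two kernels, and this action moves the empty word to the
  normal form of the acting element.

  If all labels are finite, then by the FC condition every vertex has at most one label different
  from \<open>2\<close>, because an even triangle with two labels at least \<open>4\<close> has an infinite Coxeter group.
  Hence \<open>A\<^sub>S\<close> is a direct product of cyclic groups and dihedral Artin groups. The latter are central
  extensions of \<open>\<int> * \<int>/k\<close>, and \<open>\<int> * \<int>/k\<close> is an instance of the amalgam with trivial retract.\<close>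

section \<open>Homomorphisms out of presented groups\<close>

text \<open>Let \<open>Q\<close> be the common image of the two retractions and \<open>K1\<close>,
  \<open>K2\<close> the two kernels (\<open>side\<close>). As \<open>Q\<close> is a retract of both
  factors, the amalgam is the semidirect product of the free product of \<open>K1\<close> and
  \<open>K2\<close> with \<open>Q\<close>, so g = w q with w alternating and q in \<open>Q\<close>.
  If w is empty, g survives a retraction. Otherwise a finite quotient has to keep each letter of w
  nontrivial and in its kernel, hence the demand that both retractions descend to it. The free
  product of two finite kernels is in general still infinite, hence the bound on the length of
  words. Algebra in \<open>A_S\<close> gives only the existence of w and q; that a nonempty w is
  nontrivial is read off from the action.

  For a triangle with labels 2k, 2l >= 4 the kernel of the map from W to the dihedral group of b, c
  is generated by conjugates of a. Once a commutes with c, they sit at the corners of a 2l-gon, and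
  neighbours have a product of order dividing k. As l >= 2, two corners at distance two are distinct
  and can receive plane reflections with parallel axes, whose product is a translation. The fibre
  over \<open>\<zeta>\<close> records the conjugate of a at that corner.\<close>

abbreviation word_class :: "'a set \<Rightarrow> ('a word \<times> 'a word) set \<Rightarrow> 'a word \<Rightarrow> 'a word set" where
  "word_class S R u \<equiv> word_eq S R `` {u}"

fun word_val :: "('b, 'm) monoid_scheme \<Rightarrow> ('a \<Rightarrow> 'b) \<Rightarrow> 'a word \<Rightarrow> 'b" where
  "word_val K f [] = \<one>\<^bsub>K\<^esub>"
| "word_val K f (x # u) = (if snd x then f (fst x) else inv\<^bsub>K\<^esub> f (fst x)) \<otimes>\<^bsub>K\<^esub> word_val K f u"

text \<open>The guard on \<open>x\<close> and \<open>y\<close> mirrors the rule \<open>rel\<close>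
  of \<open>word_eq\<close>, so that one fixed \<open>R\<close> can present the groups on all
  subsets of the generators.\<close>

definition satisfies ::
    "('b, 'm) monoid_scheme \<Rightarrow> ('a \<Rightarrow> 'b) \<Rightarrow> 'a set \<Rightarrow> ('a word \<times> 'a word) set \<Rightarrow> bool" where
  "satisfies K f S R \<longleftrightarrow> f \<in> S \<rightarrow> carrier K \<and>
     (\<forall>(x, y)\<in>R. x \<in> words S \<longrightarrow> y \<in> words S \<longrightarrow> word_val K f x = word_val K f y)"

lemma (in group) word_val_closed [simp]:
  "f \<in> S \<rightarrow> carrier G \<Longrightarrow> u \<in> words S \<Longrightarrow> word_val G f u \<in> carrier G"
  by (induction u) (auto intro!: m_closed inv_closed)

lemma (in group) word_val_append:
  "f \<in> S \<rightarrow> carrier G \<Longrightarrow> u \<in> words S \<Longrightarrow> v \<in> words S \<Longrightarrow>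
     word_val G f (u @ v) = word_val G f u \<otimes> word_val G f v"
proof (induction u)
  case (Cons x u)
  then have "f (fst x) \<in> carrier G" "word_val G f u \<in> carrier G" "word_val G f v \<in> carrier G" by auto
  with Cons show ?case by (auto simp: m_assoc)
qed auto

lemma word_val_cong:
  "u \<in> words S \<Longrightarrow> (\<And>s. s \<in> S \<Longrightarrow> f s = g s) \<Longrightarrow> word_val K f u = word_val K g u"
  by (induction u) auto

lemma word_val_hom:
  assumes "group G" "group K" "h \<in> hom G K" "f \<in> S \<rightarrow> carrier G" "u \<in> words S"
  shows "h (word_val G f u) = word_val K (h \<circ> f) u"
proof -
  interpret group_hom G K h using assms by (simp add: group_hom_def group_hom_axioms_def)
  show ?thesis using assms(4,5)
  proof (induction u)
    case (Cons x u)
    then have "f (fst x) \<in> carrier G" "word_val G f u \<in> carrier G" by auto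
    with Cons show ?case by auto
  qed auto
qed

lemma (in group) word_val_word_eq:
  assumes "satisfies G f S R" "(u, v) \<in> word_eq S R"
  shows "word_val G f u = word_val G f v"
  using assms(2)
proof (induction rule: word_eq.induct)
  case (cancel s u v b)
  have f: "f \<in> S \<rightarrow> carrier G" using assms(1) by (simp add: satisfies_def)
  have fs: "f s \<in> carrier G" using f cancel by auto
  have "word_val G f v \<in> carrier G" using f cancel by auto
  then have "word_val G f ([(s, b), (s, \<not> b)] @ v) = word_val G f v"
    using fs by (simp add: m_assoc[symmetric])
  with cancel f show ?case
    using word_val_append[OF f, of u "[(s, b), (s, \<not> b)] @ v"] word_val_append[OF f, of u v] by simp
next
  case (rel x y u v)
  have f: "f \<in> S \<rightarrow> carrier G" using assms(1) by (simp add: satisfies_def)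
  have "word_val G f x = word_val G f y" using assms(1) rel by (auto simp: satisfies_def)
  with rel show ?case
    by (simp add: word_val_append[OF f])
qed simp_all

text \<open>The arbitrary representative is harmless under \<open>satisfies\<close>, because then
  \<open>word_val\<close> is constant on classes (\<open>word_val_word_eq\<close>).\<close>

definition presented_hom :: "('b, 'm) monoid_scheme \<Rightarrow> ('a \<Rightarrow> 'b) \<Rightarrow> 'a word set \<Rightarrow> 'b" where
  "presented_hom K f A = word_val K f (SOME u. u \<in> A)"

lemma word_class_self: "u \<in> words S \<Longrightarrow> u \<in> word_class S R u"
  by (simp add: word_eq.refl)

lemma word_class_eq_iff:
  "u \<in> words S \<Longrightarrow> v \<in> words S \<Longrightarrow> word_class S R u = word_class S R v \<longleftrightarrow> (u, v) \<in> word_eq S R"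
  using eq_equiv_class_iff[OF equiv_word_eq] by fastforce

lemma word_class_carrier [simp]: "u \<in> words S \<Longrightarrow> word_class S R u \<in> carrier (presented_group S R)"
  by (simp add: presented_group_def quotientI)

lemma presented_group_carrierE:
  assumes "x \<in> carrier (presented_group S R)"
  obtains u where "u \<in> words S" "x = word_class S R u"
  using assms by (auto simp: presented_group_def quotient_def)

lemma one_presented_group: "\<one>\<^bsub>presented_group S R\<^esub> = word_class S R []"
  by (simp add: presented_group_def)

lemma word_class_eq_one_iff:
  "u \<in> words S \<Longrightarrow> word_class S R u = \<one>\<^bsub>presented_group S R\<^esub> \<longleftrightarrow> (u, []) \<in> word_eq S R"
  by (simp add: one_presented_group word_class_eq_iff)

lemma presented_hom_class:
  assumes "group K" "satisfies K f S R" "u \<in> words S"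
  shows "presented_hom K f (word_class S R u) = word_val K f u"
proof -
  have "(SOME v. v \<in> word_class S R u) \<in> word_class S R u"
    using word_class_self[OF assms(3)] by (rule someI)
  then show ?thesis
    using group.word_val_word_eq[OF assms(1,2)] by (auto simp: presented_hom_def)
qed

lemma presented_hom_hom:
  assumes "group K" "satisfies K f S R"
  shows "presented_hom K f \<in> hom (presented_group S R) K"
proof (rule homI)
  have f: "f \<in> S \<rightarrow> carrier K" using assms(2) by (simp add: satisfies_def)
  fix x assume "x \<in> carrier (presented_group S R)"
  then obtain u where u: "u \<in> words S" "x = word_class S R u" by (rule presented_group_carrierE)
  then show "presented_hom K f x \<in> carrier K"
    using group.word_val_closed[OF assms(1) f] by (simp add: presented_hom_class[OF assms])
  fix y assume "y \<in> carrier (presented_group S R)"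
  then obtain v where v: "v \<in> words S" "y = word_class S R v" by (rule presented_group_carrierE)
  show "presented_hom K f (x \<otimes>\<^bsub>presented_group S R\<^esub> y) = presented_hom K f x \<otimes>\<^bsub>K\<^esub> presented_hom K f y"
    using u v group.word_val_append[OF assms(1) f]
    by (simp add: mult_presented_group presented_hom_class[OF assms])
qed

abbreviation gen_class :: "'a set \<Rightarrow> ('a word \<times> 'a word) set \<Rightarrow> 'a \<Rightarrow> 'a word set" where
  "gen_class S R s \<equiv> word_class S R [(s, True)]"

lemma inv_gen_class:
  assumes "s \<in> S"
  shows "inv\<^bsub>presented_group S R\<^esub> gen_class S R s = word_class S R [(s, False)]"
proof -
  interpret group "presented_group S R" by (rule group_presented_group)
  have "([(s, False), (s, True)], []) \<in> word_eq S R"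
    using word_eq.cancel[of s S "[]" "[]" False R] assms by simp
  then have "word_class S R [(s, False), (s, True)] = \<one>\<^bsub>presented_group S R\<^esub>"
    using assms by (simp add: word_class_eq_one_iff)
  then have "word_class S R [(s, False)] \<otimes>\<^bsub>presented_group S R\<^esub> gen_class S R s = \<one>\<^bsub>presented_group S R\<^esub>"
    using assms by (simp add: mult_presented_group)
  then show ?thesis using assms by (simp add: inv_equality)
qed

lemma word_val_gen_class:
  "u \<in> words S \<Longrightarrow> word_val (presented_group S R) (gen_class S R) u = word_class S R u"
proof (induction u)
  case Nil
  then show ?case by (simp add: one_presented_group)
next
  case (Cons x u)
  obtain s b where x: "x = (s, b)" by force
  show ?case using Cons x
    by (cases b) (auto simp: inv_gen_class mult_presented_group)
qed

section \<open>Separating elements by finite quotients\<close>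

definition finite_index_normal :: "'g set \<Rightarrow> ('g, 'h) monoid_scheme \<Rightarrow> bool" where
  "finite_index_normal N G \<longleftrightarrow> N \<lhd> G \<and> finite (rcosets\<^bsub>G\<^esub> N)"

lemma residually_finite_iff:
  "residually_finite G \<longleftrightarrow>
    (\<forall>g\<in>carrier G - {\<one>\<^bsub>G\<^esub>}. \<exists>N. finite_index_normal N G \<and> g \<notin> N)"
  by (simp add: residually_finite_def finite_index_normal_def)

text \<open>The quotient by the kernel embeds into \<open>K\<close>. All finite-index normal
  subgroups below arise this way: preimages, intersections, the whole group, kernels of exponent
  maps and of permutation actions.\<close>

lemma finite_index_normal_kernel:
  assumes "group G" "group K" "h \<in> hom G K" "finite (carrier K)"
  shows "finite_index_normal {g \<in> carrier G. h g = \<one>\<^bsub>K\<^esub>} G"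
proof -
  interpret group_hom G K h using assms by (simp add: group_hom_def group_hom_axioms_def)
  have "(\<lambda>X. the_elem (h ` X)) ` carrier (G Mod kernel G K h) \<subseteq> carrier K"
    using FactGroup_the_elem_mem by blast
  then have "finite (carrier (G Mod kernel G K h))"
    using FactGroup_inj_on assms(4) by (meson finite_imageD finite_subset)
  then show ?thesis
    using normal_kernel by (simp add: finite_index_normal_def FactGroup_def kernel_def)
qed

lemma r_coset_eq_one_iff:
  assumes "N \<lhd> G" "x \<in> carrier G"
  shows "N #>\<^bsub>G\<^esub> x = \<one>\<^bsub>G Mod N\<^esub> \<longleftrightarrow> x \<in> N"
proof -
  interpret normal N G by fact
  show ?thesis using assms(2) coset_join1 coset_join2 subgroup_axioms
    by (metis one_FactGroup subset)
qed

lemma finite_index_normal_vimage: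
  assumes "group G" "group K" "h \<in> hom G K" "finite_index_normal N K"
  shows "finite_index_normal {g \<in> carrier G. h g \<in> N} G"
proof -
  interpret N: normal N K using assms(4) by (simp add: finite_index_normal_def)
  have fin: "finite (carrier (K Mod N))"
    using assms(4) by (simp add: finite_index_normal_def FactGroup_def)
  have hom: "(#>\<^bsub>K\<^esub>) N \<circ> h \<in> hom G (K Mod N)"
    using hom_compose[OF assms(3) N.r_coset_hom_Mod] .
  have "{g \<in> carrier G. h g \<in> N} = {g \<in> carrier G. ((#>\<^bsub>K\<^esub>) N \<circ> h) g = \<one>\<^bsub>K Mod N\<^esub>}"
    using assms(3) r_coset_eq_one_iff[OF N.normal_axioms] by (auto simp: hom_def)
  then show ?thesis
    using finite_index_normal_kernel[OF assms(1) N.factorgroup_is_group hom fin] by simp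
qed

text \<open>The intersection is the kernel of the diagonal map into the product of the two finite
  quotients.\<close>

lemma finite_index_normal_Int:
  assumes "group G" "finite_index_normal N G" "finite_index_normal N' G"
  shows "finite_index_normal (N \<inter> N') G"
proof -
  interpret N: normal N G using assms(2) by (simp add: finite_index_normal_def)
  interpret N': normal N' G using assms(3) by (simp add: finite_index_normal_def)
  let ?K = "(G Mod N) \<times>\<times> (G Mod N')"
  have fin: "finite (carrier ?K)"
    using assms(2,3) by (simp add: finite_index_normal_def FactGroup_def)
  have hom: "(\<lambda>x. (N #>\<^bsub>G\<^esub> x, N' #>\<^bsub>G\<^esub> x)) \<in> hom G ?K"
    using N.r_coset_hom_Mod N'.r_coset_hom_Mod by (simp add: hom_paired)
  have K: "group ?K"
    using N.factorgroup_is_group N'.factorgroup_is_group by (rule DirProd_group)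
  have "N \<inter> N' = {g \<in> carrier G. (N #>\<^bsub>G\<^esub> g, N' #>\<^bsub>G\<^esub> g) = \<one>\<^bsub>?K\<^esub>}"
    using r_coset_eq_one_iff[OF N.normal_axioms] r_coset_eq_one_iff[OF N'.normal_axioms]
      N.subset N'.subset by (auto simp: one_DirProd)
  then show ?thesis
    using finite_index_normal_kernel[OF assms(1) K hom fin] by simp
qed

lemma finite_index_normal_carrier:
  assumes "group G"
  shows "finite_index_normal (carrier G) G"
proof -
  let ?K = "G\<lparr>carrier := {\<one>\<^bsub>G\<^esub>}\<rparr>"
  have "group ?K" using group.triv_subgroup[OF assms] group.subgroup_imp_group[OF assms] by blast
  moreover have "(\<lambda>_. \<one>\<^bsub>G\<^esub>) \<in> hom G ?K" using assms by (simp add: hom_def group.is_monoid)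
  ultimately show ?thesis
    using finite_index_normal_kernel[OF assms, of ?K "\<lambda>_. \<one>\<^bsub>G\<^esub>"] by simp
qed

lemma finite_index_normal_avoiding_list:
  assumes "group G" "\<And>x. x \<in> set xs \<Longrightarrow> \<exists>N. finite_index_normal N G \<and> x \<notin> N"
  shows "\<exists>N. finite_index_normal N G \<and> set xs \<inter> N = {}"
  using assms(2)
proof (induction xs)
  case Nil
  then show ?case using finite_index_normal_carrier[OF assms(1)] by auto
next
  case (Cons x xs)
  then obtain N where N: "finite_index_normal N G" "set xs \<inter> N = {}" by auto
  obtain N' where N': "finite_index_normal N' G" "x \<notin> N'" using Cons.prems by auto
  then show ?case using N finite_index_normal_Int[OF assms(1) N(1) N'(1)] by auto
qed

lemma residually_finite_hom:
  assumes "group G" "group K" "h \<in> hom G K" "residually_finite K" "g \<in> carrier G" "h g \<noteq> \<one>\<^bsub>K\<^esub>"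
  shows "\<exists>N. finite_index_normal N G \<and> g \<notin> N"
proof -
  have "h g \<in> carrier K" using assms(3,5) by (auto simp: hom_def)
  then obtain N where "finite_index_normal N K" "h g \<notin> N"
    using assms(4,6) by (auto simp: residually_finite_iff)
  then show ?thesis using finite_index_normal_vimage[OF assms(1-3)] by blast
qed

lemma residually_finite_presented_groupI:
  assumes "\<And>w. w \<in> words S \<Longrightarrow> (w, []) \<notin> word_eq S R \<Longrightarrow>
    \<exists>N. finite_index_normal N (presented_group S R) \<and> word_class S R w \<notin> N"
  shows "residually_finite (presented_group S R)"
  unfolding residually_finite_iff
  using assms by (metis DiffE presented_group_carrierE singletonI word_class_eq_one_iff)

section \<open>Retractions onto subsets of the generators\<close>

lemma words_mono: "T \<subseteq> S \<Longrightarrow> words T \<subseteq> words S"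
  by (auto simp: words_def)

lemma word_eq_mono:
  assumes "T \<subseteq> S" "(u, v) \<in> word_eq T R"
  shows "(u, v) \<in> word_eq S R"
  using assms(2)
proof (induction rule: word_eq.induct)
  case (cancel s u v b)
  then show ?case using assms(1) words_mono[OF assms(1)] by (intro word_eq.cancel) auto
next
  case (rel x y u v)
  then show ?case using words_mono[OF assms(1)] by (intro word_eq.rel) auto
qed (use words_mono[OF assms(1)] in \<open>auto intro: word_eq.refl word_eq.sym word_eq.trans\<close>)

definition restrict_word :: "'a set \<Rightarrow> 'a word \<Rightarrow> 'a word" where
  "restrict_word T = filter (\<lambda>x. fst x \<in> T)"

lemma restrict_word_simps [simp]:
  "restrict_word T [] = []"
  "restrict_word T (x # u) = (if fst x \<in> T then x # restrict_word T u else restrict_word T u)"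
  "restrict_word T (u @ v) = restrict_word T u @ restrict_word T v"
  by (auto simp: restrict_word_def)

lemma restrict_word_words: "w \<in> words S \<Longrightarrow> restrict_word T w \<in> words (S \<inter> T)"
  by (induction w) auto

lemma restrict_word_words': "T \<subseteq> S \<Longrightarrow> w \<in> words S \<Longrightarrow> restrict_word T w \<in> words T"
  using restrict_word_words[of w S T] by (simp add: Int_absorb1)

lemma restrict_word_id: "w \<in> words T \<Longrightarrow> restrict_word T w = w"
  by (induction w) auto

text \<open>A condition on defining relations only: it is what makes the deletion of all letters
  outside \<open>T\<close> well defined on classes.\<close>

definition retractable :: "'a set \<Rightarrow> ('a word \<times> 'a word) set \<Rightarrow> 'a set \<Rightarrow> bool" where
  "retractable S R T \<longleftrightarrow> T \<subseteq> S \<and>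
    (\<forall>(x, y)\<in>R. x \<in> words S \<longrightarrow> y \<in> words S \<longrightarrow>
      (restrict_word T x, restrict_word T y) \<in> word_eq T R)"

text \<open>The target set \<open>U\<close> is left free for two uses: \<open>U = T\<close> gives
  the map onto the smaller group, and \<open>U = S\<close> the corresponding idempotent endomorphism
  of the group on \<open>S\<close>.\<close>

lemma retraction_hom:
  assumes "retractable S R T" "T \<subseteq> U"
  obtains h where "h \<in> hom (presented_group S R) (presented_group U R)"
    "\<And>w. w \<in> words S \<Longrightarrow> h (word_class S R w) = word_class U R (restrict_word T w)"
proof -
  let ?K = "presented_group U R"
  interpret K: group ?K by (rule group_presented_group)
  let ?f = "\<lambda>v. if v \<in> T then gen_class U R v else \<one>\<^bsub>?K\<^esub>"
  have TS: "T \<subseteq> S" using assms(1) by (simp add: retractable_def)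
  have rw: "restrict_word T w \<in> words U" if "w \<in> words S" for w
    using restrict_word_words'[OF TS that] words_mono[OF assms(2)] by auto
  have val: "word_val ?K ?f w = word_class U R (restrict_word T w)" if "w \<in> words S" for w
    using that
  proof (induction w)
    case Nil
    then show ?case by (simp add: one_presented_group)
  next
    case (Cons x w)
    obtain s b where x: "x = (s, b)" by force
    have w: "restrict_word T w \<in> words U" using rw Cons.prems by auto
    show ?case using Cons x w assms(2)
      by (cases b) (auto simp: inv_gen_class mult_presented_group subset_iff)
  qed
  have "word_val ?K ?f x = word_val ?K ?f y" if xy: "(x, y) \<in> R" "x \<in> words S" "y \<in> words S" for x y
  proof -
    have "(restrict_word T x, restrict_word T y) \<in> word_eq U R"
      using xy assms word_eq_mono[of T U] by (auto simp: retractable_def)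
    then show ?thesis
      using xy rw by (simp add: val word_class_eq_iff)
  qed
  moreover have "?f \<in> S \<rightarrow> carrier ?K" using assms(2) by auto
  ultimately have sat: "satisfies ?K ?f S R" by (auto simp: satisfies_def)
  show thesis
    by (rule that[OF presented_hom_hom[OF K.group_axioms sat]])
      (simp add: presented_hom_class[OF K.group_axioms sat] val)
qed

text \<open>An element that survives a retraction is separated by pulling back a finite quotient of
  the retract.\<close>

lemma separate_restriction:
  assumes "retractable S R T" "residually_finite (presented_group T R)" "w \<in> words S"
    "(restrict_word T w, []) \<notin> word_eq T R"
  shows "\<exists>N. finite_index_normal N (presented_group S R) \<and> word_class S R w \<notin> N"
proof -
  obtain h where h: "h \<in> hom (presented_group S R) (presented_group T R)"
    "\<And>w. w \<in> words S \<Longrightarrow> h (word_class S R w) = word_class T R (restrict_word T w)"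
    using retraction_hom[OF assms(1) subset_refl] by blast
  have "restrict_word T w \<in> words T"
    using assms(1,3) restrict_word_words' by (auto simp: retractable_def)
  then have "h (word_class S R w) \<noteq> \<one>\<^bsub>presented_group T R\<^esub>"
    using assms(3,4) h(2) by (simp add: word_class_eq_one_iff)
  then show ?thesis
    using residually_finite_hom[OF group_presented_group group_presented_group h(1) assms(2)] assms(3)
    by simp
qed

section \<open>Alternating lists\<close>

definition starts_in :: "'a set \<Rightarrow> 'a list \<Rightarrow> bool" where
  "starts_in H w \<longleftrightarrow> w \<noteq> [] \<and> hd w \<in> H"

lemma starts_in_simps [simp]:
  "\<not> starts_in H []"
  "starts_in H (x # w) \<longleftrightarrow> x \<in> H"
  by (auto simp: starts_in_def)

text \<open>When \<open>H\<close> and \<open>K\<close> meet at most in \<open>e\<close>, these are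
  the normal forms of the free product of \<open>H\<close> and \<open>K\<close>: no trivial letter,
  and no two consecutive letters from the same factor.\<close>

primrec alternating :: "'a \<Rightarrow> 'a set \<Rightarrow> 'a set \<Rightarrow> 'a list \<Rightarrow> bool" where
  "alternating e H K [] \<longleftrightarrow> True"
| "alternating e H K (x # w) \<longleftrightarrow> x \<noteq> e \<and> alternating e H K w \<and>
     (x \<in> H \<and> \<not> starts_in H w \<or> x \<in> K \<and> \<not> starts_in K w)"

lemma alternating_commute: "alternating e H K w \<longleftrightarrow> alternating e K H w"
  by (induction w) auto

lemma alternating_set: "alternating e H K w \<Longrightarrow> set w \<subseteq> (H \<union> K) - {e}"
  by (induction w) auto

lemma alternating_append: "alternating e H K (u @ v) \<Longrightarrow> alternating e H K v"
  by (induction u) auto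

text \<open>Only nontriviality and the factor of each letter matter, so this covers both conjugation
  by a fixed element and projection to a finite quotient, which may merge letters.\<close>

lemma alternating_map:
  assumes "alternating e H K w" "\<And>x. x \<in> set w \<Longrightarrow> f x = e' \<Longrightarrow> x = e"
    "\<And>x. x \<in> set w \<Longrightarrow> f x \<in> H' \<longleftrightarrow> x \<in> H" "\<And>x. x \<in> set w \<Longrightarrow> f x \<in> K' \<longleftrightarrow> x \<in> K"
  shows "alternating e' H' K' (map f w)"
  using assms
proof (induction w)
  case (Cons x w)
  have "starts_in H' (map f w) \<longleftrightarrow> starts_in H w" using Cons.prems by (cases w) auto
  moreover have "starts_in K' (map f w) \<longleftrightarrow> starts_in K w" using Cons.prems by (cases w) auto
  ultimately show ?case using Cons by auto
qed simp

definition first_letter :: "('a, 'm) monoid_scheme \<Rightarrow> 'a set \<Rightarrow> 'a list \<Rightarrow> 'a" where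
  "first_letter G H w = (if starts_in H w then hd w else \<one>\<^bsub>G\<^esub>)"

definition remainder :: "'a set \<Rightarrow> 'a list \<Rightarrow> 'a list" where
  "remainder H w = (if starts_in H w then tl w else w)"

definition prepend :: "('a, 'm) monoid_scheme \<Rightarrow> 'a \<Rightarrow> 'a list \<Rightarrow> 'a list" where
  "prepend G h w = (if h = \<one>\<^bsub>G\<^esub> then w else h # w)"

text \<open>Multiplication by \<open>h\<close> from the left on reduced words, truncated at length \<open>n\<close>: it does nothing
  to a word of length \<open>n\<close> that does not begin in \<open>H\<close>. It still is an action of \<open>H\<close>.\<close>

definition push :: "('a, 'm) monoid_scheme \<Rightarrow> nat \<Rightarrow> 'a set \<Rightarrow> 'a \<Rightarrow> 'a list \<Rightarrow> 'a list" where
  "push G n H h w = (if length (remainder H w) < n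
     then prepend G (h \<otimes>\<^bsub>G\<^esub> first_letter G H w) (remainder H w) else w)"

locale alternating_pair = group G for G (structure) +
  fixes H K :: "'a set"
  assumes H: "subgroup H G" and disjoint: "H \<inter> K \<subseteq> {\<one>}"
begin

abbreviation "reduced \<equiv> alternating \<one> H K"

text \<open>Coordinates for the action of \<open>H\<close>: a reduced word is a pair of an element
  \<open>h\<close> of \<open>H\<close> and a reduced word \<open>v\<close> not beginning in
  \<open>H\<close>, where \<open>h = \<one>\<close> is represented by the absence of a
  letter.\<close>

lemma reducedE:
  assumes "reduced w"
  obtains h v where "w = prepend G h v" "h \<in> H" "reduced v" "\<not> starts_in H v"
    "remainder H w = v" "first_letter G H w = h"
proof (cases "starts_in H w")
  case True
  then obtain x v where "w = x # v" "x \<in> H" by (cases w) auto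
  then show thesis using assms disjoint
    by (intro that[of x v]) (auto simp: prepend_def remainder_def first_letter_def)
next
  case False
  then show thesis using assms subgroup.one_closed[OF H]
    by (intro that[of \<one> w]) (auto simp: prepend_def remainder_def first_letter_def)
qed

lemma prepend_decomp:
  assumes "h \<in> H" "reduced v" "\<not> starts_in H v"
  shows "reduced (prepend G h v)" "remainder H (prepend G h v) = v"
    "first_letter G H (prepend G h v) = h"
  using assms by (auto simp: prepend_def remainder_def first_letter_def)

text \<open>In the coordinates of \<open>reducedE\<close> only the first component moves, by left
  multiplication, and whether it moves depends on \<open>v\<close> alone. This is why truncation
  leaves the laws of an action intact.\<close>

lemma push_prepend:
  assumes "h \<in> H" "h' \<in> H" "reduced v" "\<not> starts_in H v"
  shows "push G n H h (prepend G h' v) =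
    (if length v < n then prepend G (h \<otimes> h') v else prepend G h' v)"
  using assms by (simp add: push_def prepend_decomp)

lemma push_reduced: "reduced w \<Longrightarrow> h \<in> H \<Longrightarrow> reduced (push G n H h w)"
  by (erule reducedE) (simp add: push_prepend prepend_decomp subgroup.m_closed[OF H])

lemma push_length: "reduced w \<Longrightarrow> h \<in> H \<Longrightarrow> length w \<le> n \<Longrightarrow> length (push G n H h w) \<le> n"
  by (erule reducedE) (simp add: push_prepend, simp add: prepend_def)

lemma push_one: "reduced w \<Longrightarrow> push G n H \<one> w = w"
  by (erule reducedE) (simp add: push_prepend subgroup.one_closed[OF H] subgroup.mem_carrier[OF H])

lemma push_mult:
  "reduced w \<Longrightarrow> h \<in> H \<Longrightarrow> h' \<in> H \<Longrightarrow> push G n H h (push G n H h' w) = push G n H (h \<otimes> h') w"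
  by (erule reducedE)
    (simp add: push_prepend subgroup.m_closed[OF H] subgroup.mem_carrier[OF H] m_assoc)

lemma push_Cons:
  "reduced w \<Longrightarrow> h \<in> H \<Longrightarrow> h \<noteq> \<one> \<Longrightarrow> \<not> starts_in H w \<Longrightarrow> length w < n \<Longrightarrow> push G n H h w = h # w"
  using push_prepend[of h \<one> w n] subgroup.one_closed[OF H] subgroup.mem_carrier[OF H]
  by (simp add: prepend_def)

end

lemma (in group) inv_mult_cancel: "x \<in> carrier G \<Longrightarrow> y \<in> carrier G \<Longrightarrow> inv x \<otimes> (x \<otimes> y) = y"
  by (simp add: m_assoc[symmetric])

lemma (in group) map_push:
  assumes "\<And>x. x \<in> carrier G \<Longrightarrow> f x \<in> H \<longleftrightarrow> x \<in> H"
    "\<And>x y. x \<in> carrier G \<Longrightarrow> y \<in> carrier G \<Longrightarrow> f (x \<otimes> y) = f x \<otimes> f y"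
    "\<And>x. x \<in> carrier G \<Longrightarrow> f x = \<one> \<longleftrightarrow> x = \<one>"
    "h \<in> carrier G" "set w \<subseteq> carrier G"
  shows "map f (push G n H h w) = push G n H (f h) (map f w)"
proof -
  have rem: "remainder H (map f w) = map f (remainder H w)"
    using assms(1,5) by (cases w) (auto simp: remainder_def)
  have first: "first_letter G H (map f w) = f (first_letter G H w)"
    using assms(1,5) assms(3)[of \<one>] by (cases w) (auto simp: first_letter_def)
  have "first_letter G H w \<in> carrier G"
    using assms(5) by (cases w) (auto simp: first_letter_def)
  then have "map f (prepend G (h \<otimes> first_letter G H w) v) =
      prepend G (f h \<otimes> f (first_letter G H w)) (map f v)" for v
    using assms(2)[of h] assms(3)[of "h \<otimes> first_letter G H w"] assms(4) by (simp add: prepend_def)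
  then show ?thesis by (simp add: push_def rem first)
qed

section \<open>Pairs of commuting retractions\<close>

text \<open>The axioms pass to quotients by normal subgroups stable under both maps, so the theory
  applies to the amalgam as well as to its finite quotients.\<close>

locale retract_pair = group G for G (structure) +
  fixes r1 r2 :: "'a \<Rightarrow> 'a"
  assumes hom1: "r1 \<in> hom G G" and hom2: "r2 \<in> hom G G"
    and idem1: "x \<in> carrier G \<Longrightarrow> r1 (r1 x) = r1 x"
    and idem2: "x \<in> carrier G \<Longrightarrow> r2 (r2 x) = r2 x"
    and comm: "x \<in> carrier G \<Longrightarrow> r1 (r2 x) = r2 (r1 x)"

text \<open>The kernel of \<open>r2\<close> on the image of \<open>r1\<close>. In the amalgam these
  are the elements of one factor that die when the other distinguished generator is killed.\<close>

definition side :: "('a, 'm) monoid_scheme \<Rightarrow> ('a \<Rightarrow> 'a) \<Rightarrow> ('a \<Rightarrow> 'a) \<Rightarrow> 'a set" where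
  "side G r1 r2 = {h \<in> carrier G. r1 h = h \<and> r2 h = \<one>\<^bsub>G\<^esub>}"

definition reduced_words ::
    "('a, 'm) monoid_scheme \<Rightarrow> ('a \<Rightarrow> 'a) \<Rightarrow> ('a \<Rightarrow> 'a) \<Rightarrow> nat \<Rightarrow> 'a list set" where
  "reduced_words G r1 r2 n =
     {w. alternating \<one>\<^bsub>G\<^esub> (side G r1 r2) (side G r2 r1) w \<and> length w \<le> n}"

definition conjugate :: "('a, 'm) monoid_scheme \<Rightarrow> 'a \<Rightarrow> 'a \<Rightarrow> 'a" where
  "conjugate G q x = q \<otimes>\<^bsub>G\<^esub> x \<otimes>\<^bsub>G\<^esub> inv\<^bsub>G\<^esub> q"

text \<open>The image of \<open>r1\<close> is the semidirect product of \<open>side G r1 r2\<close> and the common image of \<open>r1\<close>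
  and \<open>r2\<close>; the latter acts on words by conjugating every letter.\<close>

definition word_action ::
    "('a, 'm) monoid_scheme \<Rightarrow> nat \<Rightarrow> ('a \<Rightarrow> 'a) \<Rightarrow> ('a \<Rightarrow> 'a) \<Rightarrow> 'a \<Rightarrow> 'a list \<Rightarrow> 'a list" where
  "word_action G n r1 r2 f w = (if w \<in> reduced_words G r1 r2 n
     then push G n (side G r1 r2) (f \<otimes>\<^bsub>G\<^esub> inv\<^bsub>G\<^esub> (r2 f)) (map (conjugate G (r2 f)) w) else w)"

lemma retract_pair_swap: "retract_pair G r1 r2 \<Longrightarrow> retract_pair G r2 r1"
  by (simp add: retract_pair_def retract_pair_axioms_def)

lemma reduced_words_swap: "reduced_words G r1 r2 n = reduced_words G r2 r1 n"
  by (simp add: reduced_words_def alternating_commute)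

context retract_pair
begin

sublocale h1: group_hom G G r1
  by unfold_locales (rule hom1)

sublocale h2: group_hom G G r2
  by unfold_locales (rule hom2)

lemma side_subgroup: "subgroup (side G r1 r2) G"
  by (rule subgroupI) (auto simp: side_def intro!: exI[of _ \<one>])

sublocale alternating_pair G "side G r1 r2" "side G r2 r1"
  by unfold_locales (use side_subgroup in \<open>auto simp: side_def\<close>)

lemma conjugate_closed [simp]: "q \<in> carrier G \<Longrightarrow> x \<in> carrier G \<Longrightarrow> conjugate G q x \<in> carrier G"
  by (simp add: conjugate_def)

lemma conjugate_one: "x \<in> carrier G \<Longrightarrow> conjugate G \<one> x = x"
  by (simp add: conjugate_def)

lemma conjugate_mult:
  "q \<in> carrier G \<Longrightarrow> x \<in> carrier G \<Longrightarrow> y \<in> carrier G \<Longrightarrow>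
     conjugate G q (x \<otimes> y) = conjugate G q x \<otimes> conjugate G q y"
  by (simp add: conjugate_def m_assoc inv_mult_cancel)

lemma conjugate_conjugate:
  "q \<in> carrier G \<Longrightarrow> q' \<in> carrier G \<Longrightarrow> x \<in> carrier G \<Longrightarrow>
     conjugate G q (conjugate G q' x) = conjugate G (q \<otimes> q') x"
  by (simp add: conjugate_def m_assoc inv_mult_group)

lemma conjugate_eq_one_iff:
  assumes "q \<in> carrier G" "x \<in> carrier G"
  shows "conjugate G q x = \<one> \<longleftrightarrow> x = \<one>"
proof
  assume "conjugate G q x = \<one>"
  then have "x = conjugate G (inv q) \<one>"
    using assms conjugate_conjugate[of "inv q" q x] by (simp add: conjugate_one)
  then show "x = \<one>" using assms by (simp add: conjugate_def)
qed (use assms in \<open>simp add: conjugate_def\<close>)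

lemma conjugate_side:
  "q \<in> carrier G \<Longrightarrow> r1 q = q \<Longrightarrow> x \<in> side G r1 r2 \<Longrightarrow> conjugate G q x \<in> side G r1 r2"
  by (auto simp: side_def conjugate_def)

lemma conjugate_side_iff:
  assumes "q \<in> carrier G" "r1 q = q" "x \<in> carrier G"
  shows "conjugate G q x \<in> side G r1 r2 \<longleftrightarrow> x \<in> side G r1 r2"
  using conjugate_side[of q x] conjugate_side[of "inv q" "conjugate G q x"] assms
  by (auto simp: conjugate_conjugate conjugate_one)

lemma reduced_words_carrier: "w \<in> reduced_words G r1 r2 n \<Longrightarrow> x \<in> set w \<Longrightarrow> x \<in> carrier G"
  by (auto simp: reduced_words_def side_def dest: alternating_set)

text \<open>This is the semidirect decomposition f = h p with p = \<open>r2 f\<close>: commutation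
  of the retractions puts p into the common image, and h = f p^-1 is killed by
  \<open>r2\<close>.\<close>

lemma split_side:
  "f \<in> carrier G \<Longrightarrow> r1 f = f \<Longrightarrow> f \<otimes> inv (r2 f) \<in> side G r1 r2"
  using comm[of f] idem2[of f] by (auto simp: side_def)

lemma map_conjugate_reduced_words:
  assumes "q \<in> carrier G" "r1 q = q" "r2 q = q" "w \<in> reduced_words G r1 r2 n"
  shows "map (conjugate G q) w \<in> reduced_words G r1 r2 n"
proof -
  interpret swap: retract_pair G r2 r1 by (rule retract_pair_swap) (rule retract_pair_axioms)
  have "alternating \<one> (side G r1 r2) (side G r2 r1) (map (conjugate G q) w)"
    by (rule alternating_map[where e = \<one> and H = "side G r1 r2" and K = "side G r2 r1"])
      (use assms reduced_words_carrier[OF assms(4)] in \<open>auto simp: reduced_words_def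
        conjugate_eq_one_iff conjugate_side_iff swap.conjugate_side_iff\<close>)
  then show ?thesis using assms(4) by (simp add: reduced_words_def)
qed

lemma map_conjugate_push:
  assumes "q \<in> carrier G" "r1 q = q" "w \<in> reduced_words G r1 r2 n" "h \<in> carrier G"
  shows "map (conjugate G q) (push G n (side G r1 r2) h w) =
    push G n (side G r1 r2) (conjugate G q h) (map (conjugate G q) w)"
  using assms reduced_words_carrier[OF assms(3)]
  by (intro map_push) (auto simp: conjugate_mult conjugate_eq_one_iff conjugate_side_iff)

lemma push_reduced_words:
  "w \<in> reduced_words G r1 r2 n \<Longrightarrow> h \<in> side G r1 r2 \<Longrightarrow>
     push G n (side G r1 r2) h w \<in> reduced_words G r1 r2 n"
  by (simp add: reduced_words_def push_reduced push_length)

lemma word_action_closed: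
  assumes "f \<in> carrier G" "r1 f = f" "w \<in> reduced_words G r1 r2 n"
  shows "word_action G n r1 r2 f w \<in> reduced_words G r1 r2 n"
  using assms comm[of f] idem2[of f]
  by (auto simp: word_action_def intro!: push_reduced_words split_side map_conjugate_reduced_words)

lemma word_action_one: "word_action G n r1 r2 \<one> w = w"
proof -
  have "map (conjugate G \<one>) w = w" if "w \<in> reduced_words G r1 r2 n"
    using reduced_words_carrier[OF that] by (simp add: map_idI conjugate_one)
  then show ?thesis by (auto simp: word_action_def push_one reduced_words_def)
qed

text \<open>The multiplication rule of a semidirect product: for f = h p and g = k q one has f g = h
  (p k p^-1) (p q), and \<open>map_conjugate_push\<close> moves the conjugation by p past the push
  by k.\<close>

lemma word_action_mult:
  assumes f: "f \<in> carrier G" "r1 f = f" and g: "g \<in> carrier G" "r1 g = g"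
  shows "word_action G n r1 r2 f (word_action G n r1 r2 g w) = word_action G n r1 r2 (f \<otimes> g) w"
proof (cases "w \<in> reduced_words G r1 r2 n")
  case True
  let ?H = "side G r1 r2" and ?p = "r2 f" and ?q = "r2 g"
  let ?h = "f \<otimes> inv ?p" and ?k = "g \<otimes> inv ?q"
  have pq: "r1 ?p = ?p" "r2 ?p = ?p" "r1 ?q = ?q" "r2 ?q = ?q"
    using f g comm idem2 by auto
  have hk: "?h \<in> ?H" "?k \<in> ?H" "conjugate G ?p ?k \<in> ?H"
    using f g pq by (auto intro: split_side conjugate_side)
  have qw: "map (conjugate G ?q) w \<in> reduced_words G r1 r2 n"
    using map_conjugate_reduced_words True g pq by simp
  have pqw: "map (conjugate G ?p) (map (conjugate G ?q) w) \<in> reduced_words G r1 r2 n"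
    using map_conjugate_reduced_words[OF _ _ _ qw] f pq by simp
  have "word_action G n r1 r2 f (word_action G n r1 r2 g w) =
      push G n ?H ?h (map (conjugate G ?p) (push G n ?H ?k (map (conjugate G ?q) w)))"
    using word_action_closed[OF g True] True by (simp add: word_action_def)
  also have "\<dots> = push G n ?H ?h (push G n ?H (conjugate G ?p ?k) (map (conjugate G ?p) (map (conjugate G ?q) w)))"
    using f g pq qw by (subst map_conjugate_push) auto
  also have "\<dots> = push G n ?H (?h \<otimes> conjugate G ?p ?k) (map (conjugate G ?p) (map (conjugate G ?q) w))"
    using pqw hk by (subst push_mult) (auto simp: reduced_words_def)
  also have "map (conjugate G ?p) (map (conjugate G ?q) w) = map (conjugate G (r2 (f \<otimes> g))) w"
    using f g reduced_words_carrier[OF True] by (simp add: conjugate_conjugate)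
  also have "?h \<otimes> conjugate G ?p ?k = (f \<otimes> g) \<otimes> inv (r2 (f \<otimes> g))"
    using f g by (simp add: conjugate_def m_assoc inv_mult_group inv_mult_cancel)
  finally show ?thesis using True by (simp add: word_action_def)
qed (simp add: word_action_def)

text \<open>The inverse is the action of \<open>inv f\<close>; the default value \<open>w\<close> of
  \<open>word_action\<close> outside the reduced words supplies the rest of
  \<open>permutes\<close>.\<close>

lemma word_action_permutes:
  assumes "f \<in> carrier G" "r1 f = f"
  shows "word_action G n r1 r2 f permutes reduced_words G r1 r2 n"
proof (rule bij_imp_permutes)
  show "bij_betw (word_action G n r1 r2 f) (reduced_words G r1 r2 n) (reduced_words G r1 r2 n)"
    by (rule bij_betw_byWitness[where f' = "word_action G n r1 r2 (inv f)"])
      (use assms word_action_closed in \<open>auto simp: word_action_mult word_action_one\<close>)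
qed (simp add: word_action_def)

text \<open>On the common image both actions are mere conjugation of letters, followed by a push by
  \<one>. This agreement glues the actions of the two factors into one action of the
  amalgam.\<close>

lemma word_action_common:
  assumes "f \<in> carrier G" "r1 f = f" "r2 f = f"
  shows "word_action G n r1 r2 f = word_action G n r2 r1 f"
proof
  fix w
  interpret swap: retract_pair G r2 r1 by (rule retract_pair_swap) (rule retract_pair_axioms)
  show "word_action G n r1 r2 f w = word_action G n r2 r1 f w"
  proof (cases "w \<in> reduced_words G r1 r2 n")
    case True
    then have "map (conjugate G f) w \<in> reduced_words G r1 r2 n"
      using map_conjugate_reduced_words assms by simp
    then show ?thesis
      using True assms by (auto simp: word_action_def reduced_words_def push_one swap.push_one
          alternating_commute[of \<one> "side G r2 r1"])
  qed (simp add: word_action_def reduced_words_swap)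
qed

lemma word_action_Nil: "q \<in> carrier G \<Longrightarrow> r2 q = q \<Longrightarrow> word_action G n r1 r2 q [] = []"
  by (simp add: word_action_def push_one)

text \<open>Since \<open>h # w\<close> still obeys the length bound, \<open>w\<close> is strictly
  shorter than \<open>n\<close> and truncation does not intervene. Letters can thus be stacked on
  the empty word one at a time.\<close>

lemma word_action_Cons:
  assumes "h # w \<in> reduced_words G r1 r2 n" "h \<in> side G r1 r2"
  shows "word_action G n r1 r2 h w = h # w"
proof -
  have w: "w \<in> reduced_words G r1 r2 n" "\<not> starts_in (side G r1 r2) w" "h \<noteq> \<one>" "length w < n"
    using assms disjoint by (auto simp: reduced_words_def)
  have "map (conjugate G \<one>) w = w"
    using reduced_words_carrier[OF w(1)] by (simp add: map_idI conjugate_one)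
  moreover have "r2 h = \<one>" "h \<in> carrier G" using assms(2) by (auto simp: side_def)
  ultimately show ?thesis
    using w assms(2) push_Cons[of w h n] by (simp add: word_action_def reduced_words_def)
qed

end

lemma (in retract_pair) finite_reduced_words:
  assumes "finite (carrier G)"
  shows "finite (reduced_words G r1 r2 n)"
proof (rule finite_subset)
  show "reduced_words G r1 r2 n \<subseteq> {w. set w \<subseteq> carrier G \<and> length w \<le> n}"
    using reduced_words_carrier by (auto simp: reduced_words_def)
  show "finite {w. set w \<subseteq> carrier G \<and> length w \<le> n}"
    using finite_lists_length_le[OF assms] .
qed

section \<open>Normal forms of elements of the amalgam\<close>

definition list_prod :: "('a, 'm) monoid_scheme \<Rightarrow> 'a list \<Rightarrow> 'a" where
  "list_prod G w = foldr (\<otimes>\<^bsub>G\<^esub>) w \<one>\<^bsub>G\<^esub>"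

lemma list_prod_simps [simp]:
  "list_prod G [] = \<one>\<^bsub>G\<^esub>"
  "list_prod G (x # w) = x \<otimes>\<^bsub>G\<^esub> list_prod G w"
  by (simp_all add: list_prod_def)

lemma (in group) list_prod_closed [simp]: "set w \<subseteq> carrier G \<Longrightarrow> list_prod G w \<in> carrier G"
  by (induction w) auto

lemma (in group) list_prod_prepend:
  "set w \<subseteq> carrier G \<Longrightarrow> h \<in> carrier G \<Longrightarrow> list_prod G (prepend G h w) = h \<otimes> list_prod G w"
  by (auto simp: prepend_def)

text \<open>The strict length bound keeps \<open>push\<close> away from truncation, so it is genuine
  left multiplication.\<close>

lemma (in alternating_pair) list_prod_push:
  assumes "reduced w" "h \<in> H" "length w < n" "set w \<subseteq> carrier G"
  shows "list_prod G (push G n H h w) = h \<otimes> list_prod G w"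
  using assms(1)
proof (rule reducedE)
  fix k v assume w: "w = prepend G k v" and "k \<in> H" "reduced v" "\<not> starts_in H v"
  then have v: "set v \<subseteq> carrier G" "k \<in> carrier G" "h \<in> carrier G" "length v < n"
    using assms subgroup.mem_carrier[OF H] by (auto simp: prepend_def split: if_splits)
  then show ?thesis
    using assms(2) \<open>k \<in> H\<close> \<open>reduced v\<close> \<open>\<not> starts_in H v\<close>
    by (simp add: w push_prepend list_prod_prepend m_assoc)
qed

text \<open>The semidirect product of the free product of both sides with the common image, seen
  inside \<open>G\<close>. The bound \<open>n\<close> is existential because lengths are limited
  only for the finite action.\<close>

definition normal_forms :: "('a, 'm) monoid_scheme \<Rightarrow> ('a \<Rightarrow> 'a) \<Rightarrow> ('a \<Rightarrow> 'a) \<Rightarrow> 'a set" where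
  "normal_forms G r1 r2 = {list_prod G w \<otimes>\<^bsub>G\<^esub> q | w q n.
     w \<in> reduced_words G r1 r2 n \<and> q \<in> carrier G \<and> r1 q = q \<and> r2 q = q}"

lemma normal_forms_swap: "normal_forms G r1 r2 = normal_forms G r2 r1"
  unfolding normal_forms_def by (subst reduced_words_swap) blast

context retract_pair
begin

lemma list_prod_map_conjugate:
  "q \<in> carrier G \<Longrightarrow> set w \<subseteq> carrier G \<Longrightarrow>
     list_prod G (map (conjugate G q) w) = conjugate G q (list_prod G w)"
  by (induction w) (auto simp: conjugate_mult, simp add: conjugate_def)

lemma one_normal_forms: "\<one> \<in> normal_forms G r1 r2"
  unfolding normal_forms_def
  by (rule CollectI, rule exI[of _ "[]"], rule exI[of _ \<one>]) (simp add: reduced_words_def)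

text \<open>With f = h p as in \<open>split_side\<close>, f w q = h (p w p^-1) (p q): the conjugated
  word absorbs h by a push, and p q stays in the common image.\<close>

lemma mult_normal_forms:
  assumes f: "f \<in> carrier G" "r1 f = f" and g: "g \<in> normal_forms G r1 r2"
  shows "f \<otimes> g \<in> normal_forms G r1 r2"
proof -
  from g obtain w q n where w: "w \<in> reduced_words G r1 r2 n"
    and q: "q \<in> carrier G" "r1 q = q" "r2 q = q" and g_eq: "g = list_prod G w \<otimes> q"
    by (auto simp: normal_forms_def)
  let ?p = "r2 f" and ?H = "side G r1 r2"
  let ?h = "f \<otimes> inv ?p"
  define v where "v = map (conjugate G ?p) w"
  have p: "?p \<in> carrier G" "r1 ?p = ?p" "r2 ?p = ?p" using f comm idem2 by auto
  have h: "?h \<in> ?H" using split_side f .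
  have wc: "set w \<subseteq> carrier G" using reduced_words_carrier[OF w] by auto
  have v: "v \<in> reduced_words G r1 r2 n" unfolding v_def
    using map_conjugate_reduced_words[OF p w] .
  then have v': "v \<in> reduced_words G r1 r2 (Suc (length v))" "set v \<subseteq> carrier G"
    using reduced_words_carrier by (auto simp: reduced_words_def)
  \<comment> \<open>The bound is one more than the length of \<open>v\<close>, so that this push is
    not truncated.\<close>
  have "list_prod G (push G (Suc (length v)) ?H ?h v) = ?h \<otimes> list_prod G v"
    using v' h by (intro list_prod_push) (auto simp: reduced_words_def)
  also have "list_prod G v = ?p \<otimes> list_prod G w \<otimes> inv ?p"
    using wc p by (simp add: v_def list_prod_map_conjugate) (simp add: conjugate_def)
  finally have "list_prod G (push G (Suc (length v)) ?H ?h v) \<otimes> (?p \<otimes> q) = f \<otimes> g"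
    using f p q wc by (simp add: g_eq m_assoc inv_mult_cancel)
  moreover have "?p \<otimes> q \<in> carrier G" "r1 (?p \<otimes> q) = ?p \<otimes> q" "r2 (?p \<otimes> q) = ?p \<otimes> q"
    using p q by auto
  ultimately show ?thesis
    using push_reduced_words[OF v'(1) h] unfolding normal_forms_def
    by (intro CollectI exI conjI) (auto elim: sym)
qed

text \<open>Each generator, and hence its inverse, is fixed by one of the retractions, and normal
  forms absorb such elements from the left.\<close>

lemma word_val_normal_forms:
  assumes "\<And>s. s \<in> S \<Longrightarrow> f s \<in> carrier G \<and> (r1 (f s) = f s \<or> r2 (f s) = f s)" "u \<in> words S"
  shows "word_val G f u \<in> normal_forms G r1 r2"
  using assms(2)
proof (induction u)
  case Nil
  then show ?case using one_normal_forms by simp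
next
  case (Cons x u)
  interpret swap: retract_pair G r2 r1 by (rule retract_pair_swap) (rule retract_pair_axioms)
  let ?y = "if snd x then f (fst x) else inv f (fst x)"
  have "?y \<in> carrier G" "r1 ?y = ?y \<or> r2 ?y = ?y"
    using Cons.prems assms(1)[of "fst x"] by (auto split: if_splits)
  then show ?case
    using Cons mult_normal_forms[of ?y] swap.mult_normal_forms[of ?y]
    by (auto simp: normal_forms_swap[of G r2 r1])
qed

section \<open>Finite quotients to which both retractions descend\<close>

lemma stable_finite_index_normal:
  assumes "finite_index_normal N G"
  obtains N' where "finite_index_normal N' G" "N' \<subseteq> N"
    "\<And>x. x \<in> N' \<Longrightarrow> r1 x \<in> N'" "\<And>x. x \<in> N' \<Longrightarrow> r2 x \<in> N'"
proof -
  let ?P = "\<lambda>M h. {g \<in> carrier G. h g \<in> M}"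
  have v: "finite_index_normal (?P M h) G" if "finite_index_normal M G" "h \<in> hom G G" for M h
    using finite_index_normal_vimage[OF is_group is_group that(2,1)] .
  have i: "finite_index_normal (M \<inter> M') G"
    if "finite_index_normal M G" "finite_index_normal M' G" for M M'
    using finite_index_normal_Int[OF is_group that] .
  \<comment> \<open>The maps id, \<open>r1\<close>, \<open>r2\<close>, \<open>r1 r2\<close> form a
    monoid because the retractions are idempotent and commute; intersecting the four preimages of
    \<open>N\<close> therefore gives a stable subgroup.\<close>
  let ?M = "N \<inter> ?P N r1"
  let ?N = "?M \<inter> ?P ?M r2"
  show thesis
  proof (rule that)
    show "finite_index_normal ?N G"
      using assms hom1 hom2 by (intro i v)
  qed (auto simp: idem1 idem2 comm)
qed

lemma quotient_retract_pair:
  assumes "N \<lhd> G" "\<And>x. x \<in> N \<Longrightarrow> r1 x \<in> N" "\<And>x. x \<in> N \<Longrightarrow> r2 x \<in> N"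
  obtains R1 R2 where "retract_pair (G Mod N) R1 R2"
    "\<And>x. x \<in> carrier G \<Longrightarrow> R1 (N #> x) = N #> r1 x"
    "\<And>x. x \<in> carrier G \<Longrightarrow> R2 (N #> x) = N #> r2 x"
proof -
  interpret N: normal N G by fact
  have ex: "\<exists>R \<in> hom (G Mod N) (G Mod N). \<forall>x\<in>carrier G. R (N #> x) = N #> r x"
    if r: "r \<in> hom G G" "\<And>x. x \<in> N \<Longrightarrow> r x \<in> N" for r
  proof -
    interpret r: group_hom G G r by unfold_locales fact
    have eq: "((#>) N \<circ> r) x = ((#>) N \<circ> r) y"
      if xy: "x \<in> carrier G" "y \<in> carrier G" "N #> x = N #> y" for x y
    proof -
      have "N #> (x \<otimes> inv y) = N" using coset_mult_inv2[OF xy(3,1,2) N.subset] .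
      then have "x \<otimes> inv y \<in> N" using xy coset_join1[OF _ _ N.subgroup_axioms] by blast
      then have "r x \<otimes> inv (r y) \<in> N" using r(2) xy by fastforce
      then have "N #> (r x \<otimes> inv (r y)) = N" using xy coset_join2 N.subgroup_axioms by auto
      then show ?thesis using coset_mult_inv1[of N "r x" "r y"] xy N.subset by simp
    qed
    show ?thesis
    proof (rule FactGroup_universal[OF Group.hom_compose[OF r(1) N.r_coset_hom_Mod] assms(1) eq])
      fix R assume "R \<in> hom (G Mod N) (G Mod N)"
        "\<And>x. x \<in> carrier G \<Longrightarrow> R (N #> x) = ((#>) N \<circ> r) x"
      then show ?thesis by (intro bexI[of _ R] ballI) simp_all
    qed
  qed
  from ex[OF hom1 assms(2)] ex[OF hom2 assms(3)] obtain R1 R2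
    where R: "R1 \<in> hom (G Mod N) (G Mod N)" "R2 \<in> hom (G Mod N) (G Mod N)"
    "\<And>x. x \<in> carrier G \<Longrightarrow> R1 (N #> x) = N #> r1 x"
    "\<And>x. x \<in> carrier G \<Longrightarrow> R2 (N #> x) = N #> r2 x" by blast
  have "retract_pair (G Mod N) R1 R2"
    unfolding retract_pair_def retract_pair_axioms_def
    using R N.factorgroup_is_group idem1 idem2 comm
    by (auto simp: FactGroup_def RCOSETS_def)
  then show thesis using that R by blast
qed

end

section \<open>Amalgamation over a common retract\<close>

definition perm_group :: "'x set \<Rightarrow> ('x \<Rightarrow> 'x) monoid" where
  "perm_group X = \<lparr>carrier = {p. p permutes X}, monoid.mult = (\<circ>), one = id\<rparr>"

lemma perm_group_simps [simp]:
  "p \<in> carrier (perm_group X) \<longleftrightarrow> p permutes X"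
  "p \<otimes>\<^bsub>perm_group X\<^esub> q = p \<circ> q"
  "\<one>\<^bsub>perm_group X\<^esub> = id"
  by (simp_all add: perm_group_def)

lemma group_perm_group: "group (perm_group X)"
proof (rule groupI)
  show "\<exists>q\<in>carrier (perm_group X). q \<otimes>\<^bsub>perm_group X\<^esub> p = \<one>\<^bsub>perm_group X\<^esub>"
    if "p \<in> carrier (perm_group X)" for p
    using that by (intro bexI[of _ "inv_into UNIV p"]) (auto simp: permutes_inv permutes_inv_o)
qed (auto simp: permutes_compose o_assoc permutes_id)

lemma finite_perm_group: "finite X \<Longrightarrow> finite (carrier (perm_group X))"
  by (simp add: perm_group_def finite_permutations)

text \<open>By \<open>word_action_mult\<close> the action is a homomorphism on the image of
  \<open>r1\<close>; the word form allows relations to be checked through values in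
  \<open>G\<close>.\<close>

lemma (in retract_pair) word_val_word_action:
  assumes "\<And>s. s \<in> T \<Longrightarrow> f s \<in> carrier G \<and> r1 (f s) = f s" "u \<in> words T"
  shows "word_val (perm_group (reduced_words G r1 r2 n)) (\<lambda>s. word_action G n r1 r2 (f s)) u =
    word_action G n r1 r2 (word_val G f u)"
    and "word_val G f u \<in> carrier G" and "r1 (word_val G f u) = word_val G f u"
proof -
  let ?P = "perm_group (reduced_words G r1 r2 n)" and ?a = "word_action G n r1 r2"
  interpret P: group ?P by (rule group_perm_group)
  have "word_val ?P (\<lambda>s. ?a (f s)) u = ?a (word_val G f u) \<and> word_val G f u \<in> carrier G \<and>
      r1 (word_val G f u) = word_val G f u"
    using assms(2)
  proof (induction u)
    case Nil
    show ?case by (auto simp: word_action_one)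
  next
    case (Cons x u)
    have f: "f (fst x) \<in> carrier G" "r1 (f (fst x)) = f (fst x)" using Cons.prems assms(1) by auto
    have "?a (inv f (fst x)) \<circ> ?a (f (fst x)) = id"
      using f by (auto simp: word_action_mult word_action_one)
    then have "inv\<^bsub>?P\<^esub> (?a (f (fst x))) = ?a (inv f (fst x))"
      using f by (intro P.inv_equality) (simp_all add: word_action_permutes)
    then show ?case
      using Cons f by (auto simp: word_action_mult)
  qed
  then show "word_val ?P (\<lambda>s. ?a (f s)) u = ?a (word_val G f u)"
    "word_val G f u \<in> carrier G" "r1 (word_val G f u) = word_val G f u" by auto
qed

text \<open>The hypothesis \<open>rel\<close> expresses the amalgam: every relation lives over
  \<open>S - {s}\<close> or over \<open>S - {t}\<close>, so a pair of actions agreeing on the other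
  generators extends to the whole group.\<close>

theorem residually_finite_amalgam:
  fixes S :: "'a set"
  assumes st: "s \<in> S" "t \<in> S" "s \<noteq> t"
    and rel: "\<And>x y. (x, y) \<in> R \<Longrightarrow> x \<in> words S \<Longrightarrow> y \<in> words S \<Longrightarrow>
      x \<in> words (S - {s}) \<and> y \<in> words (S - {s}) \<or> x \<in> words (S - {t}) \<and> y \<in> words (S - {t})"
    and ret: "retractable S R (S - {s})" "retractable S R (S - {t})"
    and rf: "residually_finite (presented_group (S - {s}) R)"
      "residually_finite (presented_group (S - {t}) R)"
  shows "residually_finite (presented_group S R)"
proof (rule residually_finite_presented_groupI)
  let ?G = "presented_group S R"
  interpret G: group ?G by (rule group_presented_group)
  obtain r1 where r1: "r1 \<in> hom ?G ?G"
    "\<And>w. w \<in> words S \<Longrightarrow> r1 (word_class S R w) = word_class S R (restrict_word (S - {s}) w)"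
    using retraction_hom[OF ret(1), of S] by blast
  obtain r2 where r2: "r2 \<in> hom ?G ?G"
    "\<And>w. w \<in> words S \<Longrightarrow> r2 (word_class S R w) = word_class S R (restrict_word (S - {t}) w)"
    using retraction_hom[OF ret(2), of S] by blast
  have rw: "restrict_word (S - {a}) w \<in> words S" if "w \<in> words S" for w a
    using restrict_word_words'[of "S - {a}" S w] that words_mono[of "S - {a}" S] by auto
  interpret retract_pair ?G r1 r2
  proof
    fix x assume "x \<in> carrier ?G"
    then obtain w where w: "w \<in> words S" "x = word_class S R w" by (rule presented_group_carrierE)
    show "r1 (r1 x) = r1 x" "r2 (r2 x) = r2 x" "r1 (r2 x) = r2 (r1 x)"
      by (simp_all add: w r1 r2 rw) (simp_all add: restrict_word_def conj_commute)
  qed (rule r1 r2)+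
  \<comment> \<open>An element fixed by a retraction is represented by a word over the retract; by
    \<open>word_eq_mono\<close> this word is nontrivial in the smaller group as well, which is
    residually finite.\<close>
  have sep: "\<exists>N. finite_index_normal N ?G \<and> x \<notin> N"
    if x: "x \<in> carrier ?G" "x \<noteq> \<one>\<^bsub>?G\<^esub>" "r1 x = x \<or> r2 x = x" for x
  proof -
    obtain w where w: "w \<in> words S" "x = word_class S R w"
      using x(1) by (rule presented_group_carrierE)
    obtain T where T: "T \<subseteq> S" "retractable S R T" "residually_finite (presented_group T R)"
      "x = word_class S R (restrict_word T w)" "restrict_word T w \<in> words S"
      using x(3)
    proof
      assume "r1 x = x"
      then show thesis using that[of "S - {s}"] ret rf w r1 rw by auto
    next
      assume "r2 x = x"
      then show thesis using that[of "S - {t}"] ret rf w r2 rw by auto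
    qed
    have "(restrict_word T w, []) \<notin> word_eq S R"
      using x(2) T by (simp add: word_class_eq_one_iff)
    then show ?thesis
      using separate_restriction[OF T(2,3) w(1)] word_eq_mono[OF T(1)] w(2) by blast
  qed
  fix w assume w: "w \<in> words S" "(w, []) \<notin> word_eq S R"
  define g where "g = word_class S R w"
  have g: "g \<in> carrier ?G" "g \<noteq> \<one>\<^bsub>?G\<^esub>"
    using w by (auto simp: g_def word_class_eq_one_iff)
  have "g \<in> normal_forms ?G r1 r2"
    using word_val_normal_forms[of S "gen_class S R" w] w(1) st
    by (auto simp: g_def word_val_gen_class r1 r2)
  then obtain ws q n where ws: "ws \<in> reduced_words ?G r1 r2 n"
    and q: "q \<in> carrier ?G" "r1 q = q" "r2 q = q" and g_eq: "g = list_prod ?G ws \<otimes>\<^bsub>?G\<^esub> q"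
    by (auto simp: normal_forms_def)
  show "\<exists>N. finite_index_normal N ?G \<and> word_class S R w \<notin> N"
  proof (cases "ws = []")
    case True
    then show ?thesis using sep[of g] g g_eq q by (auto simp: g_def)
  next
    case False
    have alt: "alternating \<one>\<^bsub>?G\<^esub> (side ?G r1 r2) (side ?G r2 r1) ws"
      using ws by (simp add: reduced_words_def)
    have ws_side: "x \<in> carrier ?G" "x \<in> side ?G r1 r2 \<or> x \<in> side ?G r2 r1" "x \<noteq> \<one>\<^bsub>?G\<^esub>"
      if "x \<in> set ws" for x
      using alternating_set[OF alt] that by (auto simp: side_def)
    have "\<exists>N. finite_index_normal N ?G \<and> x \<notin> N" if "x \<in> set ws" for x
      using sep[OF ws_side(1,3)[OF that]] ws_side(2)[OF that] by (auto simp: side_def)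
    then obtain N0 where N0: "finite_index_normal N0 ?G" "set ws \<inter> N0 = {}"
      using finite_index_normal_avoiding_list[OF G.group_axioms] by blast
    obtain N where N: "finite_index_normal N ?G" "N \<subseteq> N0"
      "\<And>x. x \<in> N \<Longrightarrow> r1 x \<in> N" "\<And>x. x \<in> N \<Longrightarrow> r2 x \<in> N"
      using stable_finite_index_normal[OF N0(1)] by blast
    interpret N: normal N ?G using N(1) by (simp add: finite_index_normal_def)
    let ?F = "?G Mod N" and ?p = "\<lambda>x. N #>\<^bsub>?G\<^esub> x"
    obtain R1 R2 where rp: "retract_pair ?F R1 R2"
      and R: "\<And>x. x \<in> carrier ?G \<Longrightarrow> R1 (?p x) = ?p (r1 x)"
        "\<And>x. x \<in> carrier ?G \<Longrightarrow> R2 (?p x) = ?p (r2 x)"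
      using quotient_retract_pair[OF N.normal_axioms N(3,4)] by blast
    interpret F: retract_pair ?F R1 R2 by (rule rp)
    interpret F': retract_pair ?F R2 R1 by (rule retract_pair_swap) (rule rp)
    have fin: "finite (carrier ?F)" using N(1) by (simp add: finite_index_normal_def FactGroup_def)
    have p: "?p \<in> hom ?G ?F" by (rule N.r_coset_hom_Mod)
    have pc: "?p x \<in> carrier ?F" if "x \<in> carrier ?G" for x using p that by (auto simp: hom_def)
    have p1: "?p \<one>\<^bsub>?G\<^esub> = \<one>\<^bsub>?F\<^esub>" using hom_one[OF p] G.group_axioms N.factorgroup_is_group by blast
    \<comment> \<open>This is the smallest bound that leaves room for the image of
      \<open>ws\<close>.\<close>
    define m where "m = length ws"
    define X where "X = reduced_words ?F R1 R2 m"
    have p_side: "?p x \<in> side ?F R1 R2" if "x \<in> side ?G r1 r2" for x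
      using that pc p1 by (auto simp: side_def R)
    have p_side': "?p x \<in> side ?F R2 R1" if "x \<in> side ?G r2 r1" for x
      using that pc p1 by (auto simp: side_def R)
    have p_ne: "?p x \<noteq> \<one>\<^bsub>?F\<^esub>" if "x \<in> set ws" for x
      using that N(2) N0(2) ws_side(1) r_coset_eq_one_iff[OF N.normal_axioms, of x] by blast
    have pws: "map ?p ws \<in> X"
    proof -
      \<comment> \<open>A nontrivial element lies in at most one side of the quotient, so the image
        of a letter cannot fall into the wrong factor and the image of \<open>ws\<close> stays
        alternating.\<close>
      have "?p x \<in> side ?F R1 R2 \<longleftrightarrow> x \<in> side ?G r1 r2" "?p x \<in> side ?F R2 R1 \<longleftrightarrow> x \<in> side ?G r2 r1"
        if "x \<in> set ws" for x
        using p_side[of x] p_side'[of x] p_ne[OF that] ws_side(2)[OF that] F.disjoint by blast+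
      then show ?thesis
        unfolding X_def reduced_words_def using p_ne
        by (auto simp: m_def intro!: alternating_map[OF alt])
    qed
    let ?P = "perm_group X"
    interpret P: group ?P by (rule group_perm_group)
    let ?a1 = "word_action ?F m R1 R2" and ?a2 = "word_action ?F m R2 R1"
    \<comment> \<open>The generator \<open>s\<close> is fixed only by the second retraction and
      \<open>t\<close> only by the first; on all others the two actions coincide, so choosing the
      first one there is no restriction.\<close>
    define \<phi> where "\<phi> v = (if v = s then ?a2 else ?a1) (?p (gen_class S R v))" for v
    have val_p: "word_val ?F (\<lambda>v. ?p (gen_class S R v)) u = ?p (word_class S R u)" if "u \<in> words S" for u
      using word_val_hom[OF G.group_axioms N.factorgroup_is_group p, of "gen_class S R" S u] that
      by (simp add: word_val_gen_class comp_def)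
    have val1: "word_val ?P \<phi> u = ?a1 (?p (word_class S R u))" if u: "u \<in> words (S - {s})" for u
    proof -
      have "word_val ?P \<phi> u = word_val ?P (\<lambda>v. ?a1 (?p (gen_class S R v))) u"
        using u by (rule word_val_cong) (simp add: \<phi>_def)
      also have "\<dots> = ?a1 (word_val ?F (\<lambda>v. ?p (gen_class S R v)) u)"
        unfolding X_def by (rule F.word_val_word_action(1)[OF _ u]) (auto simp: pc R r1)
      finally show ?thesis using val_p u words_mono[of "S - {s}" S] by auto
    qed
    have val2: "word_val ?P \<phi> u = ?a2 (?p (word_class S R u))" if u: "u \<in> words (S - {t})" for u
    proof -
      have "word_val ?P \<phi> u = word_val ?P (\<lambda>v. ?a2 (?p (gen_class S R v))) u"
        using u
      proof (rule word_val_cong)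
        fix v assume v: "v \<in> S - {t}"
        show "\<phi> v = ?a2 (?p (gen_class S R v))"
          using v F.word_action_common[of "?p (gen_class S R v)" m]
          by (auto simp: \<phi>_def pc R r1 r2)
      qed
      also have "\<dots> = ?a2 (word_val ?F (\<lambda>v. ?p (gen_class S R v)) u)"
        unfolding X_def reduced_words_swap[of ?F R1]
        by (rule F'.word_val_word_action(1)[OF _ u]) (auto simp: pc R r2)
      finally show ?thesis using val_p u words_mono[of "S - {t}" S] by auto
    qed
    have "\<phi> v permutes X" if "v \<in> S" for v
      using that F.word_action_permutes[of "?p (gen_class S R v)" m]
        F'.word_action_permutes[of "?p (gen_class S R v)" m] st
      by (auto simp: \<phi>_def X_def reduced_words_swap[of ?F R2] pc R r1 r2)
    moreover have "word_val ?P \<phi> x = word_val ?P \<phi> y"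
      if xy: "(x, y) \<in> R" "x \<in> words S" "y \<in> words S" for x y
    proof -
      have "(x, y) \<in> word_eq S R" using word_eq.rel[OF xy, of "[]" "[]"] by simp
      then have "word_class S R x = word_class S R y" using xy by (simp add: word_class_eq_iff)
      then show ?thesis using rel[OF xy] val1 val2 by metis
    qed
    ultimately have sat: "satisfies ?P \<phi> S R" by (auto simp: satisfies_def)
    define \<Phi> where "\<Phi> = presented_hom ?P \<phi>"
    have hom\<Phi>: "\<Phi> \<in> hom ?G ?P"
      unfolding \<Phi>_def using presented_hom_hom[OF P.group_axioms sat] .
    have \<Phi>1: "\<Phi> x = ?a1 (?p x)" if x: "x \<in> carrier ?G" "r1 x = x" for x
    proof -
      obtain u where u: "u \<in> words S" "x = word_class S R u" using x(1) by (rule presented_group_carrierE)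
      have "x = word_class S R (restrict_word (S - {s}) u)" using x(2) u r1 by simp
      then show ?thesis
        using val1[OF restrict_word_words'[OF _ u(1)]] presented_hom_class[OF P.group_axioms sat rw[OF u(1)]]
        by (simp add: \<Phi>_def)
    qed
    have \<Phi>2: "\<Phi> x = ?a2 (?p x)" if x: "x \<in> carrier ?G" "r2 x = x" for x
    proof -
      obtain u where u: "u \<in> words S" "x = word_class S R u" using x(1) by (rule presented_group_carrierE)
      have "x = word_class S R (restrict_word (S - {t}) u)" using x(2) u r2 by simp
      then show ?thesis
        using val2[OF restrict_word_words'[OF _ u(1)]] presented_hom_class[OF P.group_axioms sat rw[OF u(1)]]
        by (simp add: \<Phi>_def)
    qed
    have \<Phi>_Nil: "\<Phi> q [] = []"
    proof -
      have "R2 (?p q) = ?p q" using R(2) q by simp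
      then show ?thesis using \<Phi>1[OF q(1,2)] pc[OF q(1)] by (simp add: F.word_action_Nil)
    qed
    \<comment> \<open>Induction over suffixes of \<open>ws\<close>: q fixes the empty word, and each
      further letter is put in front of what has been built.\<close>
    have "\<Phi> (list_prod ?G v \<otimes>\<^bsub>?G\<^esub> q) [] = map ?p v" if "\<exists>u. ws = u @ v" for v
      using that
    proof (induction v)
      case Nil
      then show ?case using \<Phi>_Nil q by simp
    next
      case (Cons x v)
      then obtain u where u: "ws = u @ x # v" by blast
      then have "\<exists>u. ws = u @ v" by (metis append.assoc append_Cons append_Nil)
      then have IH: "\<Phi> (list_prod ?G v \<otimes>\<^bsub>?G\<^esub> q) [] = map ?p v" by (rule Cons.IH)
      have x: "x \<in> carrier ?G" "x \<in> side ?G r1 r2 \<or> x \<in> side ?G r2 r1" and v: "set v \<subseteq> carrier ?G"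
        using ws_side u by auto
      have "map ?p u @ map ?p (x # v) \<in> X" using pws u by simp
      then have X: "map ?p (x # v) \<in> X"
        using alternating_append by (fastforce simp: X_def reduced_words_def)
      have "\<Phi> (list_prod ?G (x # v) \<otimes>\<^bsub>?G\<^esub> q) = \<Phi> x \<circ> \<Phi> (list_prod ?G v \<otimes>\<^bsub>?G\<^esub> q)"
        using hom\<Phi> x v q by (simp add: hom_def G.m_assoc)
      then have "\<Phi> (list_prod ?G (x # v) \<otimes>\<^bsub>?G\<^esub> q) [] = \<Phi> x (map ?p v)" using IH by simp
      also have "\<dots> = map ?p (x # v)"
        using x(2)
      proof
        assume s: "x \<in> side ?G r1 r2"
        then have "\<Phi> x = ?a1 (?p x)" by (intro \<Phi>1) (auto simp: side_def)
        then show ?thesis using F.word_action_Cons[OF _ p_side[OF s]] X by (simp add: X_def)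
      next
        assume s: "x \<in> side ?G r2 r1"
        then have "\<Phi> x = ?a2 (?p x)" by (intro \<Phi>2) (auto simp: side_def)
        then show ?thesis using F'.word_action_Cons[OF _ p_side'[OF s]] X
          by (simp add: X_def reduced_words_swap[of ?F R1])
      qed
      finally show ?case .
    qed
    then have "\<Phi> g [] = map ?p ws" using g_eq by simp
    then have "\<Phi> g \<noteq> \<one>\<^bsub>?P\<^esub>" using False by auto
    moreover have "finite (carrier ?P)"
      unfolding X_def using F.finite_reduced_words[OF fin] by (rule finite_perm_group)
    ultimately show ?thesis
      using finite_index_normal_kernel[OF G.group_axioms P.group_axioms hom\<Phi>] by (auto simp: g_def)
  qed
qed

section \<open>Direct products\<close>

lemma (in group) commute_inv:
  assumes "a \<in> carrier G" "b \<in> carrier G" "a \<otimes> b = b \<otimes> a"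
  shows "a \<otimes> inv b = inv b \<otimes> a"
proof -
  have "a = b \<otimes> (a \<otimes> inv b)" using assms by (simp add: m_assoc[symmetric]) (simp add: m_assoc flip: assms(3))
  then show ?thesis using inv_solve_left[of "a \<otimes> inv b" b a] assms(1,2) by simp
qed

lemma (in group) subgroup_center: "subgroup {h \<in> carrier G. \<forall>g\<in>carrier G. g \<otimes> h = h \<otimes> g} G"
proof (rule subgroupI, goal_cases)
  case (4 a b)
  then have ab: "a \<in> carrier G" "b \<in> carrier G"
    "\<And>g. g \<in> carrier G \<Longrightarrow> g \<otimes> a = a \<otimes> g" "\<And>g. g \<in> carrier G \<Longrightarrow> g \<otimes> b = b \<otimes> g" by auto
  have "g \<otimes> (a \<otimes> b) = a \<otimes> b \<otimes> g" if g: "g \<in> carrier G" for g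
  proof -
    have "g \<otimes> (a \<otimes> b) = a \<otimes> g \<otimes> b" unfolding ab(3)[OF g, symmetric] using ab(1,2) g by (simp add: m_assoc)
    also have "\<dots> = a \<otimes> (b \<otimes> g)" unfolding ab(4)[OF g, symmetric] using ab(1,2) g by (simp add: m_assoc)
    finally show ?thesis using ab(1,2) g by (simp add: m_assoc)
  qed
  then show ?case using ab(1,2) by simp
qed (auto intro: commute_inv)

lemma (in group) word_val_commute:
  assumes "f \<in> S \<rightarrow> carrier G" "a \<in> carrier G" "\<And>s. s \<in> S \<Longrightarrow> a \<otimes> f s = f s \<otimes> a" "u \<in> words S"
  shows "a \<otimes> word_val G f u = word_val G f u \<otimes> a"
  using assms(4)
proof (induction u)
  case (Cons x u)
  let ?y = "if snd x then f (fst x) else inv f (fst x)"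
  have y: "?y \<in> carrier G" "a \<otimes> ?y = ?y \<otimes> a" and u: "word_val G f u \<in> carrier G"
    using Cons.prems assms commute_inv[of a "f (fst x)"] by auto
  have "a \<otimes> (?y \<otimes> word_val G f u) = ?y \<otimes> (a \<otimes> word_val G f u)"
    using y u assms(2) by (simp add: m_assoc[symmetric])
  then show ?case using Cons y u assms(2) by (simp add: m_assoc)
qed (use assms(2) in simp)

text \<open>An element is the product of its restrictions to \<open>T\<close> and \<open>U\<close>;
  if it is nontrivial, one of them is, and that retraction separates it.\<close>

theorem residually_finite_product:
  assumes S: "S = T \<union> U" "T \<inter> U = {}"
    and ret: "retractable S R T" "retractable S R U"
    and comm: "\<And>t u. t \<in> T \<Longrightarrow> u \<in> U \<Longrightarrow>
      ([(t, True), (u, True)], [(u, True), (t, True)]) \<in> word_eq S R"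
    and rf: "residually_finite (presented_group T R)" "residually_finite (presented_group U R)"
  shows "residually_finite (presented_group S R)"
proof (rule residually_finite_presented_groupI)
  let ?G = "presented_group S R" and ?c = "word_class S R"
  interpret G: group ?G by (rule group_presented_group)
  have rw: "restrict_word T w \<in> words S" "restrict_word U w \<in> words S" "restrict_word T w \<in> words T"
    if "w \<in> words S" for w
    using restrict_word_words'[of T S w] restrict_word_words'[of U S w] that words_mono[of _ S] S
    by blast+
  have gen: "gen_class S R \<in> S \<rightarrow> carrier ?G" by simp
  have split: "?c w = ?c (restrict_word T w) \<otimes>\<^bsub>?G\<^esub> ?c (restrict_word U w)" if "w \<in> words S" for w
    using that
  proof (induction w)
    case Nil
    then show ?case by (simp add: mult_presented_group)
  next
    case (Cons x w)
    let ?x = "?c [x]"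
    let ?t = "?c (restrict_word T w)" and ?u = "?c (restrict_word U w)"
    have x: "fst x \<in> S" "?x \<in> carrier ?G" and w: "w \<in> words S" using Cons.prems by auto
    have c: "?c (x # v) = ?x \<otimes>\<^bsub>?G\<^esub> ?c v" if "v \<in> words S" for v
      using that x by (simp add: mult_presented_group)
    have tu: "?t \<in> carrier ?G" "?u \<in> carrier ?G" using rw w by auto
    have IH: "?c (x # w) = ?x \<otimes>\<^bsub>?G\<^esub> (?t \<otimes>\<^bsub>?G\<^esub> ?u)" using Cons.IH[OF w] c[OF w] by (simp only:)
    show ?case
    proof (cases "fst x \<in> T")
      case True
      then have "fst x \<notin> U" using S by auto
      then show ?thesis using True x tu c[OF rw(1)[OF w]] unfolding IH by (simp add: G.m_assoc)
    next
      case False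
      \<comment> \<open>A letter from \<open>U\<close> has to pass the \<open>T\<close>-part of
        \<open>w\<close>; inverse letters inherit commutation through
        \<open>commute_inv\<close>.\<close>
      then have U: "fst x \<in> U" using S x by auto
      have gx: "gen_class S R (fst x) \<in> carrier ?G" using x by simp
      have "gen_class S R (fst x) \<otimes>\<^bsub>?G\<^esub> gen_class S R v = gen_class S R v \<otimes>\<^bsub>?G\<^esub> gen_class S R (fst x)"
        if "v \<in> T" for v
        using comm[OF that U] that S x by (simp add: mult_presented_group word_class_eq_iff word_eq.sym)
      then have "gen_class S R (fst x) \<otimes>\<^bsub>?G\<^esub> word_val ?G (gen_class S R) (restrict_word T w) =
          word_val ?G (gen_class S R) (restrict_word T w) \<otimes>\<^bsub>?G\<^esub> gen_class S R (fst x)"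
        using S rw[OF w] gx by (intro G.word_val_commute[where S = T]) auto
      then have xt: "?t \<otimes>\<^bsub>?G\<^esub> gen_class S R (fst x) = gen_class S R (fst x) \<otimes>\<^bsub>?G\<^esub> ?t"
        using rw[OF w] by (simp add: word_val_gen_class)
      have "?t \<otimes>\<^bsub>?G\<^esub> ?x = ?x \<otimes>\<^bsub>?G\<^esub> ?t"
        using xt G.commute_inv[OF tu(1) gx xt] x(1)
        by (cases x; cases "snd x") (auto simp: inv_gen_class)
      then have "?c (x # w) = ?t \<otimes>\<^bsub>?G\<^esub> (?x \<otimes>\<^bsub>?G\<^esub> ?u)"
        unfolding IH using x tu by (simp flip: G.m_assoc)
      then show ?thesis using False U c[OF rw(2)[OF w]] by simp
    qed
  qed
  fix w assume w: "w \<in> words S" "(w, []) \<notin> word_eq S R"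
  have "(restrict_word T w, []) \<notin> word_eq T R \<or> (restrict_word U w, []) \<notin> word_eq U R"
  proof (rule ccontr)
    assume "\<not> ?thesis"
    then have "?c (restrict_word T w) = \<one>\<^bsub>?G\<^esub>" "?c (restrict_word U w) = \<one>\<^bsub>?G\<^esub>"
      using S rw[OF w(1)] word_eq_mono[of T S] word_eq_mono[of U S]
      by (auto simp: word_class_eq_one_iff)
    then have "?c w = \<one>\<^bsub>?G\<^esub>" using split[OF w(1)] by simp
    then show False using w by (simp add: word_class_eq_one_iff)
  qed
  then show "\<exists>N. finite_index_normal N ?G \<and> ?c w \<notin> N"
    using separate_restriction ret rf w(1) by blast
qed

section \<open>Cyclic groups\<close>

text \<open>The homomorphism from the free group to the integers with prescribed values on
  generators; weights make it possible to count a single generator.\<close>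

definition exponent_sum :: "('a \<Rightarrow> int) \<Rightarrow> 'a word \<Rightarrow> int" where
  "exponent_sum g w = (\<Sum>x\<leftarrow>w. if snd x then g (fst x) else - g (fst x))"

lemma exponent_sum_simps [simp]:
  "exponent_sum g [] = 0"
  "exponent_sum g (x # w) = (if snd x then g (fst x) else - g (fst x)) + exponent_sum g w"
  by (simp_all add: exponent_sum_def)

lemma exponent_hom:
  assumes "m > 0"
    "\<And>x y. (x, y) \<in> R \<Longrightarrow> x \<in> words S \<Longrightarrow> y \<in> words S \<Longrightarrow>
      exponent_sum g x mod int m = exponent_sum g y mod int m"
  obtains h where "h \<in> hom (presented_group S R) (integer_mod_group m)"
    "\<And>w. w \<in> words S \<Longrightarrow> h (word_class S R w) = exponent_sum g w mod int m"
proof -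
  let ?K = "integer_mod_group m" and ?f = "\<lambda>v. g v mod int m"
  interpret K: group ?K by simp
  have f: "?f v \<in> carrier ?K" for v using assms(1) by (simp add: carrier_integer_mod_group)
  have val: "word_val ?K ?f w = exponent_sum g w mod int m" for w
    by (induction w)
      (auto simp: f inv_integer_mod_group mult_integer_mod_group one_integer_mod_group mod_simps)
  have sat: "satisfies ?K ?f S R"
    using assms(2) f by (auto simp: satisfies_def val)
  show thesis
    by (rule that[OF presented_hom_hom[OF K.group_axioms sat]])
      (simp add: presented_hom_class[OF K.group_axioms sat] val)
qed

lemma separate_exponent_hom:
  assumes "m > 0" "h \<in> hom (presented_group S R) (integer_mod_group m)"
    "g \<in> carrier (presented_group S R)" "h g \<noteq> 0"
  shows "\<exists>N. finite_index_normal N (presented_group S R) \<and> g \<notin> N"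
proof -
  have "finite (carrier (integer_mod_group m))" using assms(1) by (simp add: carrier_integer_mod_group)
  from finite_index_normal_kernel[OF group_presented_group group_integer_mod_group assms(2) this]
  show ?thesis using assms(3,4) by (auto simp: one_integer_mod_group)
qed

lemma (in group) word_val_replicate:
  "f s \<in> carrier G \<Longrightarrow> word_val G f (replicate n (s, True)) = f s [^] n"
  by (induction n) (simp_all add: nat_pow_Suc2[symmetric] del: nat_pow_Suc)

lemma exponent_sum_replicate: "exponent_sum g (replicate n (s, True)) = int n * g s"
  by (induction n) (simp_all add: algebra_simps)

lemma replicate_words [simp]: "replicate n (s, b) \<in> words S \<longleftrightarrow> n = 0 \<or> s \<in> S"
  by (induction n) auto

text \<open>The case \<open>m = 0\<close> is that of an infinite cyclic group.\<close>

lemma residually_finite_cyclic: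
  fixes m :: nat
  assumes "\<And>x y. (x, y) \<in> R \<Longrightarrow> x \<in> words {s} \<Longrightarrow> y \<in> words {s} \<Longrightarrow>
      exponent_sum (\<lambda>_. 1) x mod int m = exponent_sum (\<lambda>_. 1) y mod int m"
    and "(replicate m (s, True), []) \<in> word_eq {s} R"
  shows "residually_finite (presented_group {s} R)"
proof (rule residually_finite_presented_groupI)
  let ?G = "presented_group {s} R" and ?a = "gen_class {s} R s"
  interpret G: group ?G by (rule group_presented_group)
  have a: "?a \<in> carrier ?G" by simp
  have pow: "word_class {s} R w = ?a [^]\<^bsub>?G\<^esub> exponent_sum (\<lambda>_. 1) w" if "w \<in> words {s}" for w
    using that
  proof (induction w)
    case Nil
    then show ?case by (simp add: one_presented_group)
  next
    case (Cons x w)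
    have "word_class {s} R (x # w) = word_class {s} R [x] \<otimes>\<^bsub>?G\<^esub> word_class {s} R w"
      using Cons.prems by (simp add: mult_presented_group)
    also have "word_class {s} R [x] = ?a [^]\<^bsub>?G\<^esub> (if snd x then 1 else - 1 :: int)"
      using Cons.prems inv_gen_class[of s "{s}" R]
      by (cases x) (auto simp: G.int_pow_neg G.int_pow_1)
    finally show ?case using Cons by (simp add: G.int_pow_mult)
  qed
  have "?a [^]\<^bsub>?G\<^esub> m = \<one>\<^bsub>?G\<^esub>"
    using assms(2) G.word_val_replicate[of "gen_class {s} R" s m]
      word_class_eq_one_iff[of "replicate m (s, True)" "{s}" R]
    by (simp add: word_val_gen_class)
  then have am: "?a [^]\<^bsub>?G\<^esub> int m = \<one>\<^bsub>?G\<^esub>" by (simp add: int_pow_int)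
  fix w assume w: "w \<in> words {s}" "(w, []) \<notin> word_eq {s} R"
  define e where "e = exponent_sum (\<lambda>_. 1) w"
  have e: "?a [^]\<^bsub>?G\<^esub> e \<noteq> \<one>\<^bsub>?G\<^esub>"
    using w(2) unfolding e_def pow[OF w(1), symmetric] word_class_eq_one_iff[OF w(1)] .
  have "\<not> int m dvd e"
  proof
    assume "int m dvd e"
    then obtain j where "e = int m * j" by blast
    then show False using e G.int_pow_pow[OF a, of "int m" j] am by simp
  qed
  \<comment> \<open>In the infinite case e is nonzero and any modulus exceeding its absolute value
    detects it.\<close>
  define n where "n = (if m = 0 then nat \<bar>e\<bar> + 1 else m)"
  have n: "n > 0" "e mod int n \<noteq> 0"
  proof -
    show "e mod int n \<noteq> 0"
    proof
      assume "e mod int n = 0"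
      then have "int n dvd e" by (rule mod_0_imp_dvd)
      then show False using \<open>\<not> int m dvd e\<close> zdvd_imp_le[of "int n" "\<bar>e\<bar>"]
        by (auto simp: n_def split: if_splits)
    qed
  qed (auto simp: n_def)
  obtain h where h: "h \<in> hom ?G (integer_mod_group n)"
    "\<And>w. w \<in> words {s} \<Longrightarrow> h (word_class {s} R w) = exponent_sum (\<lambda>_. 1) w mod int n"
    by (rule exponent_hom[OF n(1), of R "{s}" "\<lambda>_. 1"]) (use assms(1) in \<open>auto simp: n_def split: if_splits\<close>)
  then show "\<exists>N. finite_index_normal N ?G \<and> word_class {s} R w \<notin> N"
    using separate_exponent_hom[OF n(1) h(1)] n(2) w(1) by (simp add: e_def)
qed

section \<open>Artin groups of dihedral type\<close>

text \<open>Both sides are the alternating product b a b ... b with 2k + 1 factors. Hence (a b)^k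
  commutes with a and b as soon as it equals (b a)^k.\<close>

lemma (in group) pow_mult_swap:
  "a \<in> carrier G \<Longrightarrow> b \<in> carrier G \<Longrightarrow> (b \<otimes> a) [^] (k :: nat) \<otimes> b = b \<otimes> (a \<otimes> b) [^] k"
proof (induction k)
  case (Suc k)
  have "(b \<otimes> a) [^] Suc k \<otimes> b = (b \<otimes> a) [^] k \<otimes> b \<otimes> (a \<otimes> b)"
    using Suc.prems by (simp add: m_assoc)
  then show ?case using Suc by (simp add: m_assoc)
qed simp

lemma (in group) pow_mult_eq_one_swap:
  assumes "a \<in> carrier G" "b \<in> carrier G" "(a \<otimes> b) [^] (k :: nat) = \<one>"
  shows "(b \<otimes> a) [^] k = \<one>"
  using pow_mult_swap[OF assms(1,2), of k] assms by simp

lemma (in group) word_val_alt_word: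
  assumes "f a \<in> carrier G" "f b \<in> carrier G"
  shows "word_val G f (alt_word a b (2 * k)) = (f a \<otimes> f b) [^] k"
proof (induction k)
  case (Suc k)
  then show ?case
    using assms nat_pow_Suc2[of "f a \<otimes> f b" k] by (simp add: m_assoc)
qed simp

lemma exponent_sum_alt_word: "exponent_sum g (alt_word a b (2 * k)) = int k * (g a + g b)"
  by (induction k) (simp_all add: algebra_simps)

lemma alt_word_words:
  "n \<ge> 2 \<Longrightarrow> alt_word a b n \<in> words S \<longleftrightarrow> a \<in> S \<and> b \<in> S"
proof -
  have *: "a \<in> S \<Longrightarrow> b \<in> S \<Longrightarrow> alt_word a b n \<in> words S" for a b n
    by (induction n arbitrary: a b) auto
  assume "n \<ge> 2"
  then obtain m where "n = Suc (Suc m)" by (metis Suc_le_D numeral_2_eq_2 Suc_le_mono)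
  then show ?thesis using * by auto
qed

lemma residually_finite_free_product_cyclic:
  assumes "s \<noteq> t" "k > 0"
  shows "residually_finite (presented_group {s, t} {(replicate k (t, True), [])})"
proof (rule residually_finite_amalgam[of s _ t])
  let ?R = "{(replicate k (t, True), [])}"
  have diff: "{s, t} - {s} = {t}" "{s, t} - {t} = {s}" using assms(1) by auto
  have r: "restrict_word T (replicate k (t, True)) = (if t \<in> T then replicate k (t, True) else [])" for T
    by (simp add: restrict_word_def)
  have rel: "(replicate k (t, True), []) \<in> word_eq {t} ?R"
    using word_eq.rel[of _ _ ?R "{t}" "[]" "[]"] by simp
  then show "retractable {s, t} ?R ({s, t} - {s})" "retractable {s, t} ?R ({s, t} - {t})"
    unfolding diff using assms by (auto simp: retractable_def r intro: word_eq.refl)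
  show "residually_finite (presented_group ({s, t} - {s}) ?R)"
    unfolding diff by (rule residually_finite_cyclic[of _ _ k])
      (use rel in \<open>auto simp: exponent_sum_replicate\<close>)
  \<comment> \<open>As k > 0, the relator contains \<open>t\<close>, so the group on
    \<open>s\<close> alone is infinite cyclic; this is the parameter 0.\<close>
  show "residually_finite (presented_group ({s, t} - {t}) ?R)"
    unfolding diff by (rule residually_finite_cyclic[of _ _ 0])
      (use assms in \<open>auto intro: word_eq.refl\<close>)
qed (use assms in auto)

text \<open>With \<open>u = st\<close> the relation \<open>(st)\<^sup>k = (ts)\<^sup>k\<close> says that \<open>z = u\<^sup>k\<close> is central, and the quotient
  by \<open>\<langle>z\<rangle>\<close> is \<open>\<langle>s\<rangle> * \<langle>u | u\<^sup>k\<rangle>\<close>. In the free product the letter \<open>t\<close> plays the role of \<open>u\<close>.\<close>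

theorem residually_finite_dihedral:
  assumes st: "s \<noteq> t" and k: "k > 0"
    and R: "R = {(alt_word s t (2 * k), alt_word t s (2 * k)), (alt_word t s (2 * k), alt_word s t (2 * k))}"
  shows "residually_finite (presented_group {s, t} R)"
proof (rule residually_finite_presented_groupI)
  let ?S = "{s, t}"
  let ?RB = "{(replicate k (t, True), [])}"
  let ?G = "presented_group ?S R" and ?B = "presented_group ?S ?RB"
  interpret G: group ?G by (rule group_presented_group)
  interpret B: group ?B by (rule group_presented_group)
  define x y where "x = gen_class ?S R s" and "y = gen_class ?S R t"
  have xy: "x \<in> carrier ?G" "y \<in> carrier ?G" by (simp_all add: x_def y_def)
  define z where "z = (x \<otimes>\<^bsub>?G\<^esub> y) [^]\<^bsub>?G\<^esub> k"
  have z: "z \<in> carrier ?G" using xy by (simp add: z_def)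
  have alt: "alt_word s t (2 * k) \<in> words ?S" "alt_word t s (2 * k) \<in> words ?S"
    using k by (simp_all add: alt_word_words)
  have z_class: "z = word_class ?S R (alt_word s t (2 * k))"
    using G.word_val_alt_word[of "gen_class ?S R" s t k] word_val_gen_class[OF alt(1)]
    by (simp add: z_def x_def y_def)
  have "(y \<otimes>\<^bsub>?G\<^esub> x) [^]\<^bsub>?G\<^esub> k = word_class ?S R (alt_word t s (2 * k))"
    using G.word_val_alt_word[of "gen_class ?S R" t s k] word_val_gen_class[OF alt(2)]
    by (simp add: x_def y_def)
  also have "\<dots> = z"
    unfolding z_class using alt word_eq.rel[of _ _ R ?S "[]" "[]"] by (simp add: word_class_eq_iff R)
  finally have z': "(y \<otimes>\<^bsub>?G\<^esub> x) [^]\<^bsub>?G\<^esub> k = z" .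
  have "z \<otimes>\<^bsub>?G\<^esub> x = x \<otimes>\<^bsub>?G\<^esub> z" "z \<otimes>\<^bsub>?G\<^esub> y = y \<otimes>\<^bsub>?G\<^esub> z"
    using G.pow_mult_swap[of y x k] G.pow_mult_swap[of x y k] xy z' by (simp_all add: z_def)
  then have z_gen: "z \<otimes>\<^bsub>?G\<^esub> gen_class ?S R v = gen_class ?S R v \<otimes>\<^bsub>?G\<^esub> z" if "v \<in> ?S" for v
    using that by (auto simp: x_def y_def)
  have z_central: "g \<otimes>\<^bsub>?G\<^esub> z = z \<otimes>\<^bsub>?G\<^esub> g" if "g \<in> carrier ?G" for g
  proof -
    obtain u where "u \<in> words ?S" "g = word_class ?S R u" using \<open>g \<in> carrier ?G\<close> by (rule presented_group_carrierE)
    then show ?thesis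
      using G.word_val_commute[where S = ?S and a = z and u = u and f = "gen_class ?S R"] z z_gen by (simp add: word_val_gen_class)
  qed
  define Z where "Z = generate ?G {z}"
  let ?C = "{h \<in> carrier ?G. \<forall>g\<in>carrier ?G. g \<otimes>\<^bsub>?G\<^esub> h = h \<otimes>\<^bsub>?G\<^esub> g}"
  have "subgroup ?C ?G" by (rule G.subgroup_center)
  then have Z_central: "Z \<subseteq> ?C"
    unfolding Z_def using z z_central by (intro G.generate_subgroup_incl) auto
  have Z: "Z \<lhd> ?G"
    unfolding G.normal_inv_iff
  proof (intro conjI ballI)
    show "subgroup Z ?G" unfolding Z_def using z by (intro G.generate_is_subgroup) auto
    fix g h assume "g \<in> carrier ?G" "h \<in> Z"
    moreover have "g \<otimes>\<^bsub>?G\<^esub> h = h \<otimes>\<^bsub>?G\<^esub> g" "h \<in> carrier ?G" using calculation Z_central by auto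
    ultimately show "g \<otimes>\<^bsub>?G\<^esub> h \<otimes>\<^bsub>?G\<^esub> inv\<^bsub>?G\<^esub> g \<in> Z" by (simp add: G.m_assoc)
  qed
  interpret Z: normal Z ?G by (rule Z)
  let ?Q = "?G Mod Z" and ?p = "(#>\<^bsub>?G\<^esub>) Z"
  interpret Q: group ?Q by (rule Z.factorgroup_is_group)
  interpret p: group_hom ?G ?Q ?p by unfold_locales (rule Z.r_coset_hom_Mod)
  \<comment> \<open>The substitution u = st solved for t: t goes to s^-1 u, with u written as the
    generator \<open>t\<close> of \<open>?B\<close>.\<close>
  define fB where "fB v = (if v = s then gen_class ?S ?RB s
    else inv\<^bsub>?B\<^esub> gen_class ?S ?RB s \<otimes>\<^bsub>?B\<^esub> gen_class ?S ?RB t)" for v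
  have fBc: "fB v \<in> carrier ?B" for v by (simp add: fB_def)
  have "fB s \<otimes>\<^bsub>?B\<^esub> fB t = gen_class ?S ?RB t"
    using st by (simp add: fB_def flip: B.m_assoc)
  moreover have "gen_class ?S ?RB t [^]\<^bsub>?B\<^esub> k = \<one>\<^bsub>?B\<^esub>"
    using B.word_val_replicate[of "gen_class ?S ?RB" t k] word_eq.rel[of _ _ ?RB ?S "[]" "[]"]
      word_class_eq_one_iff[of "replicate k (t, True)" ?S ?RB]
    by (simp add: word_val_gen_class)
  ultimately have "(fB s \<otimes>\<^bsub>?B\<^esub> fB t) [^]\<^bsub>?B\<^esub> k = \<one>\<^bsub>?B\<^esub>" by simp
  moreover from this have "(fB t \<otimes>\<^bsub>?B\<^esub> fB s) [^]\<^bsub>?B\<^esub> k = \<one>\<^bsub>?B\<^esub>"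
    using B.pow_mult_eq_one_swap fBc by blast
  ultimately have satB: "satisfies ?B fB ?S R"
    unfolding satisfies_def using fBc by (auto simp: R B.word_val_alt_word)
  define \<theta> where "\<theta> = presented_hom ?B fB"
  have \<theta>: "\<theta> \<in> hom ?G ?B" unfolding \<theta>_def by (rule presented_hom_hom[OF B.group_axioms satB])
  \<comment> \<open>The substitution in the other direction; it is defined modulo \<open>Z\<close>,
    since the relator goes to (x y)^k = z.\<close>
  define fQ where "fQ v = (if v = s then ?p x else ?p (x \<otimes>\<^bsub>?G\<^esub> y))" for v
  have fQc: "fQ v \<in> carrier ?Q" for v using p.hom_closed[OF xy(1)] p.hom_closed[OF G.m_closed[OF xy]]
    by (cases "v = s") (simp_all only: fQ_def simp_thms if_True if_False)
  have fQt: "fQ t = ?p (x \<otimes>\<^bsub>?G\<^esub> y)" using st by (auto simp: fQ_def)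
  have "fQ t [^]\<^bsub>?Q\<^esub> k = ?p z"
    unfolding fQt z_def by (rule p.hom_nat_pow[OF G.m_closed[OF xy], symmetric])
  also have "\<dots> = \<one>\<^bsub>?Q\<^esub>"
    using r_coset_eq_one_iff[OF Z z] by (simp add: Z_def generate.incl)
  finally have satQ: "satisfies ?Q fQ ?S ?RB"
    unfolding satisfies_def using fQc Q.word_val_replicate[where f = fQ and s = t, OF fQc] by auto
  define \<sigma> where "\<sigma> = presented_hom ?Q fQ"
  have \<sigma>: "\<sigma> \<in> hom ?B ?Q" unfolding \<sigma>_def by (rule presented_hom_hom[OF Q.group_axioms satQ])
  interpret \<sigma>: group_hom ?B ?Q \<sigma> by unfold_locales (rule \<sigma>)
  have \<sigma>_gen: "\<sigma> (gen_class ?S ?RB v) = fQ v" if "v \<in> ?S" for v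
    unfolding \<sigma>_def using that presented_hom_class[OF Q.group_axioms satQ, of "[(v, True)]"] Q.r_one[OF fQc[of v]]
    by (simp del: mult_FactGroup one_FactGroup)
  have \<sigma>fB: "\<sigma> (fB v) = ?p (gen_class ?S R v)" if "v \<in> ?S" for v
  proof (cases "v = s")
    case True
    then show ?thesis using \<sigma>_gen[of s] by (simp add: fB_def fQ_def x_def)
  next
    case False
    then have v: "v = t" using that by simp
    have "\<sigma> (fB t) = inv\<^bsub>?Q\<^esub> (?p x) \<otimes>\<^bsub>?Q\<^esub> ?p (x \<otimes>\<^bsub>?G\<^esub> y)"
      unfolding fB_def using st \<sigma>_gen[of s] \<sigma>_gen[of t] by (simp add: fQ_def)
    also have "\<dots> = inv\<^bsub>?Q\<^esub> (?p x) \<otimes>\<^bsub>?Q\<^esub> (?p x \<otimes>\<^bsub>?Q\<^esub> ?p y)"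
      using p.hom_mult[OF xy] by (simp only:)
    also have "\<dots> = ?p y"
      using p.hom_closed[OF xy(1)] p.hom_closed[OF xy(2)] by (rule Q.inv_mult_cancel)
    finally show ?thesis using v by (simp add: y_def)
  qed
  \<comment> \<open>Since the composite is the projection modulo \<open>Z\<close>, the kernel of
    \<theta> lies in \<open>Z\<close>.\<close>
  have \<sigma>\<theta>: "\<sigma> (\<theta> (word_class ?S R w)) = ?p (word_class ?S R w)" if w: "w \<in> words ?S" for w
  proof -
    have "\<sigma> (\<theta> (word_class ?S R w)) = word_val ?Q (\<sigma> \<circ> fB) w"
      using presented_hom_class[OF B.group_axioms satB w]
        word_val_hom[OF B.group_axioms Q.group_axioms \<sigma> _ w, of fB] fBc by (simp add: \<theta>_def)
    also have "\<dots> = word_val ?Q (?p \<circ> gen_class ?S R) w"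
      using w by (rule word_val_cong) (simp add: \<sigma>fB)
    also have "\<dots> = ?p (word_class ?S R w)"
      using word_val_hom[OF G.group_axioms Q.group_axioms Z.r_coset_hom_Mod _ w, of "gen_class ?S R"] w
      by (simp add: word_val_gen_class)
    finally show ?thesis .
  qed
  fix w assume w: "w \<in> words ?S" "(w, []) \<notin> word_eq ?S R"
  define g where "g = word_class ?S R w"
  have g: "g \<in> carrier ?G" "g \<noteq> \<one>\<^bsub>?G\<^esub>" using w by (auto simp: g_def word_class_eq_one_iff)
  show "\<exists>N. finite_index_normal N ?G \<and> word_class ?S R w \<notin> N"
  proof (cases "\<theta> g = \<one>\<^bsub>?B\<^esub>")
    case False
    then show ?thesis
      using residually_finite_hom[OF G.group_axioms B.group_axioms \<theta>
          residually_finite_free_product_cyclic[OF st k] g(1)] by (simp add: g_def)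
  next
    case True
    then have "?p g = \<one>\<^bsub>?Q\<^esub>" using \<sigma>\<theta>[OF w(1)] by (simp only: g_def \<sigma>.hom_one)
    then have "g \<in> Z" using r_coset_eq_one_iff[OF Z g(1)] by blast
    then obtain j :: int where j: "g = z [^]\<^bsub>?G\<^esub> j" using G.generate_pow[OF z] by (auto simp: Z_def)
    then have "j \<noteq> 0" using g by auto
    \<comment> \<open>Counting occurrences of \<open>t\<close> is compatible with the relation and
      gives k on z, hence j k on g = z^j. This is nonzero and smaller in absolute value than the
      modulus.\<close>
    define m where "m = nat \<bar>j * int k\<bar> + 1"
    have m: "m > 0" by (simp add: m_def)
    obtain h where h: "h \<in> hom ?G (integer_mod_group m)"
      "\<And>w. w \<in> words ?S \<Longrightarrow> h (word_class ?S R w) =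
        exponent_sum (\<lambda>v. if v = t then 1 else 0) w mod int m"
      by (rule exponent_hom[OF m, of R ?S "\<lambda>v. if v = t then 1 else 0"])
        (auto simp: R exponent_sum_alt_word)
    interpret h: group_hom ?G "integer_mod_group m" h
      by (simp add: group_hom_def group_hom_axioms_def h(1) G.group_axioms)
    have "h z = int k mod int m"
      unfolding z_class using st by (simp add: h(2)[OF alt(1)] exponent_sum_alt_word)
    then have "h g = j * int k mod int m"
      using z by (simp add: j h.hom_int_pow int_pow_integer_mod_group mod_simps)
    moreover have "j * int k mod int m \<noteq> 0"
    proof
      assume "j * int k mod int m = 0"
      then have "int m dvd \<bar>j * int k\<bar>" by (simp add: mod_0_imp_dvd)
      moreover have "\<bar>j * int k\<bar> > 0" using \<open>j \<noteq> 0\<close> k by simp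
      ultimately have "int m \<le> \<bar>j * int k\<bar>" by (rule zdvd_imp_le)
      then show False by (simp add: m_def)
    qed
    ultimately show ?thesis using separate_exponent_hom[OF m h(1) g(1)] by (simp add: g_def)
  qed
qed

section \<open>Infinite even Coxeter groups of rank three\<close>

text \<open>For involutions (b a)^k is the inverse of (a b)^k, and (a b)^(2k) = 1 makes the latter
  its own inverse.\<close>

lemma word_val_involution_alt_word:
  assumes "group G" "f a \<in> carrier G" "f b \<in> carrier G"
    "f a \<otimes>\<^bsub>G\<^esub> f a = \<one>\<^bsub>G\<^esub>" "f b \<otimes>\<^bsub>G\<^esub> f b = \<one>\<^bsub>G\<^esub>"
    "(f a \<otimes>\<^bsub>G\<^esub> f b) [^]\<^bsub>G\<^esub> (2 * k) = \<one>\<^bsub>G\<^esub>"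
  shows "word_val G f (alt_word a b (2 * k)) = word_val G f (alt_word b a (2 * k))"
proof -
  interpret group G by fact
  let ?u = "(f a \<otimes>\<^bsub>G\<^esub> f b) [^]\<^bsub>G\<^esub> k"
  have "inv\<^bsub>G\<^esub> (f a \<otimes>\<^bsub>G\<^esub> f b) = f b \<otimes>\<^bsub>G\<^esub> f a"
    using assms(2-5) inv_equality by (simp add: inv_mult_group)
  then have "(f b \<otimes>\<^bsub>G\<^esub> f a) [^]\<^bsub>G\<^esub> k = inv\<^bsub>G\<^esub> ?u"
    using assms(2,3) by (simp flip: nat_pow_inv)
  also have "\<dots> = ?u"
    using assms(2,3,6) nat_pow_pow[of "f a \<otimes>\<^bsub>G\<^esub> f b" k 2] inv_equality[of ?u ?u]
    by (simp add: numeral_2_eq_2 mult.commute)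
  finally show ?thesis using assms(2,3) by (simp add: word_val_alt_word)
qed

lemma perm_group_pow: "p [^]\<^bsub>perm_group X\<^esub> n = p ^^ n"
  by (induction n) (simp_all add: nat_pow_def perm_group_def funpow_swap1 fun_eq_iff)

text \<open>The reflections \<open>x\<close>, \<open>y\<close>, \<open>z\<close> of the plane have axes such that those of \<open>x\<close> and \<open>z\<close> are
  distinct and parallel, and both meet the axis of \<open>y\<close> at the angle \<open>\<pi> / k\<close>.\<close>

definition refl_x :: "nat \<Rightarrow> complex \<Rightarrow> complex" where
  "refl_x k v = cis (2 * pi / k) * cnj v"

definition refl_z :: "nat \<Rightarrow> complex \<Rightarrow> complex" where
  "refl_z k v = cis (2 * pi / k) * cnj v + \<i> * cis (pi / k)"

lemma cis_mult_cnj: "cis t * cnj (cis t) = 1"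
  by (simp add: cis_cnj cis_mult)

lemma cis_cnj_cancel:
  "cnj (cis t) * cis t = 1" "cis t * (cnj (cis t) * v) = v" "cnj (cis t) * (cis t * v) = v"
proof -
  show "cnj (cis t) * cis t = 1" by (metis cis_mult_cnj mult.commute)
  then show "cis t * (cnj (cis t) * v) = v" "cnj (cis t) * (cis t * v) = v"
    by (simp_all add: cis_mult_cnj flip: mult.assoc)
qed

text \<open>The vector \<open>\<i> * cis (pi / k)\<close> is normal to the common direction of the
  two axes: z reverses it, and xz is a translation along it.\<close>

lemma refl_involution: "refl_x k (refl_x k v) = v" "refl_z k (refl_z k v) = v"
  and refl_xz: "refl_x k (refl_z k v) = v - \<i> * cis (pi / k)"
proof -
  define e h where "e = cis (2 * pi / k)" and "h = cis (pi / k)"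
  have eh: "e * cnj e = 1" "e * cnj h = h" by (simp_all add: e_def h_def cis_cnj cis_mult)
  have *: "e * (cnj e * v) = v" using eh(1) by (simp flip: mult.assoc)
  have "e * cnj (e * cnj v + \<i> * h) = e * (cnj e * v) - \<i> * (e * cnj h)"
    by (simp add: algebra_simps)
  also have "\<dots> = v - \<i> * h" by (simp add: * eh)
  finally show "refl_x k (refl_z k v) = v - \<i> * cis (pi / k)" "refl_z k (refl_z k v) = v"
    by (simp_all add: refl_x_def refl_z_def flip: e_def h_def)
  show "refl_x k (refl_x k v) = v" using * by (simp add: refl_x_def flip: e_def)
qed

lemma cis_root: "k > 0 \<Longrightarrow> cis (2 * pi / real k) ^ k = 1"
  by (simp add: DeMoivre)

lemma cis_root_ne_one:
  assumes "k \<ge> 2"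
  shows "cis (2 * pi / real k) \<noteq> 1"
proof
  assume "cis (2 * pi / real k) = 1"
  then have "cos (2 * pi / real k) = cos 0" by (simp add: complex_eq_iff)
  moreover have "0 < 2 * pi / real k" "2 * pi / real k \<le> pi"
    using assms by (auto simp: field_simps)
  ultimately show False using cos_inj_pi[of "2 * pi / real k" 0] by simp
qed

text \<open>Each composite is a rotation v -> a v + b with a^k = 1 and a \<noteq> 1; the translation
  part of its k-th power is b times a vanishing geometric sum.\<close>

lemma refl_funpow:
  assumes "k \<ge> 2"
  shows "((\<lambda>v. refl_x k (cnj v)) ^^ k) = id" "((\<lambda>v. cnj (refl_x k v)) ^^ k) = id"
    "((\<lambda>v. refl_z k (cnj v)) ^^ k) = id" "((\<lambda>v. cnj (refl_z k v)) ^^ k) = id"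
proof -
  let ?e = "cis (2 * pi / real k)"
  have e: "?e ^ k = 1" "?e \<noteq> 1" using assms cis_root[of k] cis_root_ne_one[of k] by auto
  then have e': "cnj ?e ^ k = 1" "cnj ?e \<noteq> 1"
    by (metis complex_cnj_power complex_cnj_one, metis complex_cnj_cancel_iff complex_cnj_one)
  have affine: "((\<lambda>v. a * v + b) ^^ n) v = a ^ n * v + b * (\<Sum>i<n. a ^ i)" for a b v :: complex and n
  proof (induction n)
    case (Suc n)
    have "(\<Sum>i<Suc n. a ^ i) = 1 + a * (\<Sum>i<n. a ^ i)"
      by (simp only: sum.lessThan_Suc_shift) (simp add: sum_distrib_left)
    then show ?case using Suc by (simp add: algebra_simps)
  qed simp
  have *: "((\<lambda>v. a * v + b) ^^ k) = id" if "a ^ k = 1" "a \<noteq> 1" for a b :: complex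
    using that by (auto simp: affine sum_gp_strict)
  show "((\<lambda>v. refl_x k (cnj v)) ^^ k) = id" using *[of ?e 0] e by (simp add: refl_x_def)
  show "((\<lambda>v. cnj (refl_x k v)) ^^ k) = id" using *[of "cnj ?e" 0] e' by (simp add: refl_x_def)
  show "((\<lambda>v. refl_z k (cnj v)) ^^ k) = id" using *[of ?e "\<i> * cis (pi / k)"] e by (simp add: refl_z_def)
  show "((\<lambda>v. cnj (refl_z k v)) ^^ k) = id"
    using *[of "cnj ?e" "cnj (\<i> * cis (pi / k))"] e' by (simp add: refl_z_def)
qed

text \<open>The group generated by \<open>b\<close> and \<open>c\<close> acts on the first coordinate as a dihedral group; the
  generator \<open>a\<close> acts on the fibre over \<open>\<zeta>\<close> by a reflection depending on \<open>\<zeta>\<close>.\<close>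

definition fibre_refl :: "nat \<Rightarrow> nat \<Rightarrow> complex \<Rightarrow> complex \<Rightarrow> complex" where
  "fibre_refl k l \<zeta> = (if \<zeta> = 1 then refl_x k else if \<zeta> ^ l = 1 then refl_z k else cnj)"

definition act_a :: "nat \<Rightarrow> nat \<Rightarrow> complex \<times> complex \<Rightarrow> complex \<times> complex" where
  "act_a k l p = (fst p, fibre_refl k l (fst p) (snd p))"

text \<open>With \<open>act_c\<close> this makes bc the rotation of the first coordinate by pi / l,
  whose order 2l is the label of b and c.\<close>

definition act_b :: "nat \<Rightarrow> complex \<times> complex \<Rightarrow> complex \<times> complex" where
  "act_b l p = (cis (pi / l) * cnj (fst p), snd p)"

definition act_c :: "complex \<times> complex \<Rightarrow> complex \<times> complex" where
  "act_c p = (cnj (fst p), snd p)"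

text \<open>The number 1 and the set of l-th roots of unity are stable under conjugation; this is
  what makes a commute with c.\<close>

lemma fibre_refl_cnj: "fibre_refl k l (cnj \<zeta>) = fibre_refl k l \<zeta>"
proof -
  have "cnj \<zeta> = 1 \<longleftrightarrow> \<zeta> = 1" "cnj \<zeta> ^ l = 1 \<longleftrightarrow> \<zeta> ^ l = 1"
    by (metis complex_cnj_cnj complex_cnj_one, metis complex_cnj_cnj complex_cnj_one complex_cnj_power)
  then show ?thesis by (simp add: fibre_refl_def)
qed

lemma act_involutions: "act_a k l \<circ> act_a k l = id" "act_b l \<circ> act_b l = id" "act_c \<circ> act_c = id"
proof -
  show "act_b l \<circ> act_b l = id" by (auto simp: act_b_def fun_eq_iff cis_cnj_cancel)
qed (auto simp: act_a_def act_c_def fun_eq_iff fibre_refl_def refl_involution)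

lemma act_ac: "act_a k l \<circ> act_c = act_c \<circ> act_a k l"
  by (auto simp: act_a_def act_c_def fibre_refl_cnj)

lemma act_bc_funpow: "((act_b l \<circ> act_c) ^^ n) p = (cis (pi / l) ^ n * fst p, snd p)"
  by (induction n arbitrary: p) (auto simp: act_b_def act_c_def)

lemma cis_pi_power: "l > 0 \<Longrightarrow> cis (pi / real l) ^ l = - 1"
  by (simp add: DeMoivre)

lemma act_bc: "l > 0 \<Longrightarrow> (act_b l \<circ> act_c) ^^ (2 * l) = id"
  by (auto simp: fun_eq_iff act_bc_funpow power_mult mult.commute[of 2] cis_pi_power)

text \<open>The square of ab preserves every fibre and acts there by the reflections at
  \<open>\<zeta>\<close> and at its image under b. Since b exchanges \<open>\<zeta> ^ l = 1\<close>
  with \<open>\<zeta> ^ l = - 1\<close>, exactly one of them is \<open>cnj\<close> over such points,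
  and the product is a rotation of order dividing k; over all other points both are
  \<open>cnj\<close> and cancel.\<close>

lemma act_ab:
  assumes "k \<ge> 2" "l \<ge> 2"
  shows "(act_a k l \<circ> act_b l) ^^ (2 * k) = id"
proof -
  define g where "g \<zeta> = (\<lambda>v. fibre_refl k l \<zeta> (fibre_refl k l (cis (pi / l) * cnj \<zeta>) v))" for \<zeta>
  have sq: "(act_a k l \<circ> act_b l) ^^ 2 = (\<lambda>p. (fst p, g (fst p) (snd p)))"
    by (auto simp: numeral_2_eq_2 act_a_def act_b_def g_def fun_eq_iff cis_cnj_cancel)
  have pow: "((\<lambda>p. (fst p, g (fst p) (snd p))) ^^ n) p = (fst p, (g (fst p) ^^ n) (snd p))" for n p
    by (induction n) auto
  have "g \<zeta> ^^ k = id" for \<zeta>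
  proof -
    have next_pow: "(cis (pi / l) * cnj \<zeta>) ^ l = - cnj (\<zeta> ^ l)"
      using assms(2) by (simp add: power_mult_distrib cis_pi_power)
    consider "\<zeta> ^ l = 1" | "\<zeta> ^ l = - 1" | "\<zeta> ^ l \<noteq> 1" "\<zeta> ^ l \<noteq> - 1" by blast
    then show ?thesis
    proof cases
      case 1
      then have "(cis (pi / l) * cnj \<zeta>) ^ l = - 1" using next_pow by simp
      then have "fibre_refl k l (cis (pi / l) * cnj \<zeta>) = cnj"
        by (auto simp: fibre_refl_def)
      moreover have "fibre_refl k l \<zeta> = refl_x k \<or> fibre_refl k l \<zeta> = refl_z k"
        using 1 by (simp add: fibre_refl_def)
      ultimately show ?thesis using refl_funpow[OF assms(1)] by (auto simp: g_def)
    next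
      case 2
      then have "(cis (pi / l) * cnj \<zeta>) ^ l = 1" using next_pow by simp
      then have "fibre_refl k l (cis (pi / l) * cnj \<zeta>) = refl_x k \<or>
          fibre_refl k l (cis (pi / l) * cnj \<zeta>) = refl_z k"
        by (simp add: fibre_refl_def)
      moreover have "fibre_refl k l \<zeta> = cnj" using 2 by (auto simp: fibre_refl_def)
      ultimately show ?thesis using refl_funpow[OF assms(1)] by (auto simp: g_def)
    next
      case 3
      then have "cnj (\<zeta> ^ l) \<noteq> - 1" by (metis complex_cnj_cnj complex_cnj_minus complex_cnj_one)
      then have "(cis (pi / l) * cnj \<zeta>) ^ l \<noteq> 1" using next_pow by (metis minus_minus)
      then have "cis (pi / l) * cnj \<zeta> \<noteq> 1" by auto
      moreover have "\<zeta> \<noteq> 1" using 3 by auto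
      ultimately have "g \<zeta> = id"
        using 3 \<open>(cis (pi / l) * cnj \<zeta>) ^ l \<noteq> 1\<close> by (auto simp: g_def fibre_refl_def fun_eq_iff)
      then show ?thesis by simp
    qed
  qed
  then have "((\<lambda>p. (fst p, g (fst p) (snd p))) ^^ k) = id" by (simp add: fun_eq_iff pow)
  then show ?thesis by (simp add: funpow_mult sq flip: funpow_mult)
qed

lemma infinite_coxeter_group:
  assumes abc: "a \<noteq> b" "b \<noteq> c" "a \<noteq> c"
    and M: "coxeter_matrix {a, b, c} M"
    and ab: "M a b = enat (2 * k)" "k \<ge> 2" and bc: "M b c = enat (2 * l)" "l \<ge> 2"
    and ac: "M a c = enat (2 * m)"
  shows "infinite (carrier (coxeter_group {a, b, c} M))"
proof
  let ?S = "{a, b, c}"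
  let ?R = "artin_relations ?S M \<union> {([(s, True), (s, True)], []) | s. s \<in> ?S}"
  let ?P = "perm_group (UNIV :: (complex \<times> complex) set)"
  interpret P: group ?P by (rule group_perm_group)
  interpret W: group "coxeter_group ?S M" unfolding coxeter_group_def by (rule group_presented_group)
  define f where "f v = (if v = a then act_a k l else if v = b then act_b l else act_c)" for v
  have f: "f a = act_a k l" "f b = act_b l" "f c = act_c" using abc by (auto simp: f_def)
  have inv: "f v \<circ> f v = id" for v by (simp add: f_def act_involutions)
  then have fc: "f v \<in> carrier ?P" for v
    using o_bij[OF inv inv] by (auto intro: bij_imp_permutes)
  have sym: "(f t \<circ> f s) ^^ n = id" if st: "(f s \<circ> f t) ^^ n = id" for s t and n :: nat
    using P.pow_mult_eq_one_swap[of "f s" "f t" n] st fc by (simp add: perm_group_pow)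
  have fab: "(f a \<circ> f b) ^^ (2 * k) = id" using act_ab[OF ab(2) bc(2)] by (simp add: f)
  have fbc: "(f b \<circ> f c) ^^ (2 * l) = id" using act_bc[of l] bc(2) by (simp add: f)
  \<comment> \<open>The images of a and c commute, so every even label 2m of this pair is
    respected.\<close>
  have "(f a \<circ> f c) ^^ 2 = id"
  proof -
    have "(f a \<circ> f c) ^^ 2 = (f a \<circ> f c) \<circ> (f c \<circ> f a)"
      using act_ac[of k l] by (simp add: numeral_2_eq_2 f)
    also have "\<dots> = f a \<circ> (f c \<circ> f c) \<circ> f a" by (simp only: o_assoc)
    finally show ?thesis by (simp add: inv)
  qed
  then have fac: "(f a \<circ> f c) ^^ (2 * m) = id" by (simp flip: funpow_mult)
  have M_sym: "M s t = M t s" if "s \<in> ?S" "t \<in> ?S" for s t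
    using M that by (cases "s = t") (auto simp: coxeter_matrix_def)
  have braid: "word_val ?P f (alt_word s t n) = word_val ?P f (alt_word t s n)"
    if "s \<in> ?S" "t \<in> ?S" "s \<noteq> t" "M s t = enat n" for s t n
  proof -
    have "\<exists>j. n = 2 * j \<and> (f s \<circ> f t) ^^ (2 * j) = id"
      using that fab fbc fac sym[OF fab] sym[OF fbc] sym[OF fac] ab(1) bc(1) ac
        M_sym[of a b] M_sym[of b c] M_sym[of a c] by auto
    then obtain j where "n = 2 * j" "(f s \<circ> f t) ^^ (2 * j) = id" by blast
    then show ?thesis
      using word_val_involution_alt_word[where f = f and a = s and b = t and k = j,
          OF P.group_axioms fc fc] inv
      by (simp add: perm_group_pow)
  qed
  have sat: "satisfies ?P f ?S ?R"
    unfolding satisfies_def using fc braid inv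
    by (auto simp: artin_relations_def simp del: perm_group_simps(1))
  define \<Phi> where "\<Phi> = presented_hom ?P f"
  have \<Phi>: "\<Phi> \<in> hom (coxeter_group ?S M) ?P"
    unfolding \<Phi>_def coxeter_group_def by (rule presented_hom_hom[OF P.group_axioms sat])
  (* modulo c^2 = b^2 = 1 this is a (bc)^(-2) a (bc)^2, which acts on the fibre over 1 as the translation xz *)
  define w where "w = [(a, True), (c, True), (b, True), (c, True), (b, True), (a, True),
    (b, True), (c, True), (b, True), (c, True)]"
  have w: "w \<in> words ?S" by (simp add: w_def)
  define \<tau> where "\<tau> = \<i> * cis (pi / k)"
  have val_w: "word_val ?P f w (1, v) = (1, v - \<tau>)" for v
  proof -
    let ?e = "cis (pi / real l)"
    have e: "?e * ?e = cis (2 * pi / real l)" by (simp add: cis_mult)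
    \<comment> \<open>Here l >= 2 enters: (bc)^2 moves the base point 1 to another l-th root of
      unity, over which a acts by z instead of x.\<close>
    have "?e * ?e \<noteq> 1" using cis_root_ne_one[OF bc(2)] by (simp add: e)
    moreover have "(?e * ?e) ^ l = 1" using bc(2) by (simp add: e cis_root)
    ultimately have "fibre_refl k l (?e * ?e) = refl_z k" by (simp add: fibre_refl_def)
    then show ?thesis
      by (simp add: w_def f act_a_def act_b_def act_c_def \<tau>_def refl_xz mult.assoc cis_cnj_cancel)
        (simp add: fibre_refl_def refl_xz)
  qed
  have pow_w: "(word_val ?P f w ^^ n) (1, 0) = (1, - (of_nat n * \<tau>))" for n :: nat
    by (induction n) (auto simp: val_w algebra_simps)
  define g where "g = word_class ?S ?R w"
  have g: "g \<in> carrier (coxeter_group ?S M)" using w by (simp add: g_def coxeter_group_def)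
  have \<Phi>g: "\<Phi> g = word_val ?P f w"
    unfolding \<Phi>_def g_def by (rule presented_hom_class[OF P.group_axioms sat w])
  have "inj (\<lambda>n :: nat. g [^]\<^bsub>coxeter_group ?S M\<^esub> n)"
  proof (rule injI)
    fix i j :: nat
    assume "g [^]\<^bsub>coxeter_group ?S M\<^esub> i = g [^]\<^bsub>coxeter_group ?S M\<^esub> j"
    then have "\<Phi> g [^]\<^bsub>?P\<^esub> i = \<Phi> g [^]\<^bsub>?P\<^esub> j"
      using hom_nat_pow[OF \<Phi> g W.group_axioms P.group_axioms] by metis
    then have "(word_val ?P f w ^^ i) (1, 0) = (word_val ?P f w ^^ j) (1, 0)"
      by (simp add: perm_group_pow \<Phi>g)
    then show "i = j" by (simp add: pow_w \<tau>_def)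
  qed
  moreover have "range (\<lambda>n :: nat. g [^]\<^bsub>coxeter_group ?S M\<^esub> n) \<subseteq> carrier (coxeter_group ?S M)"
    using g by auto
  moreover assume "finite (carrier (coxeter_group ?S M))"
  ultimately show False using finite_subset range_inj_infinite by blast
qed

section \<open>Even Artin groups\<close>

lemma word_eq_relations_mono:
  assumes "(u, v) \<in> word_eq S R"
    "\<And>x y. (x, y) \<in> R \<Longrightarrow> x \<in> words S \<Longrightarrow> y \<in> words S \<Longrightarrow> (x, y) \<in> R'"
  shows "(u, v) \<in> word_eq S R'"
  using assms(1)
proof (induction rule: word_eq.induct)
  case (rel x y u v)
  then show ?case using assms(2) by (intro word_eq.rel) auto
next
  case (cancel s u v b)
  then show ?case by (rule word_eq.cancel)
qed (auto intro: word_eq.refl word_eq.sym word_eq.trans)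

lemma presented_group_cong:
  assumes "\<And>x y. x \<in> words S \<Longrightarrow> y \<in> words S \<Longrightarrow> (x, y) \<in> R \<longleftrightarrow> (x, y) \<in> R'"
  shows "presented_group S R = presented_group S R'"
proof -
  have "word_eq S R = word_eq S R'"
    using word_eq_relations_mono[of _ _ S R R'] word_eq_relations_mono[of _ _ S R' R] assms by auto
  then show ?thesis by (simp add: presented_group_def)
qed

lemma coxeter_matrix_subset: "coxeter_matrix S M \<Longrightarrow> T \<subseteq> S \<Longrightarrow> coxeter_matrix T M"
  by (auto simp: coxeter_matrix_def)

lemma even_type_subset: "even_type S M \<Longrightarrow> T \<subseteq> S \<Longrightarrow> even_type T M"
  by (auto simp: even_type_def)

lemma FC_type_subset: "FC_type S M \<Longrightarrow> T \<subseteq> S \<Longrightarrow> FC_type T M"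
  unfolding FC_type_def by (meson subset_trans)

lemma even_labelE:
  assumes "coxeter_matrix S M" "even_type S M" "s \<in> S" "t \<in> S" "s \<noteq> t" "M s t \<noteq> \<infinity>"
  obtains k where "M s t = enat (2 * k)" "k \<ge> 1"
proof -
  obtain m where m: "M s t = enat m" using assms(6) by auto
  then have "even m" using assms(2-5) by (auto simp: even_type_def)
  moreover have "M s t \<ge> 2" using assms(1,3-5) unfolding coxeter_matrix_def by blast
  then have "m \<ge> 2" by (simp add: m numeral_eq_enat)
  ultimately show thesis using m that by (elim evenE) auto
qed

lemma artin_relationsE:
  assumes "coxeter_matrix S M" "even_type S M" "(x, y) \<in> artin_relations S M"
  obtains s t k where "s \<in> S" "t \<in> S" "s \<noteq> t" "M s t = enat (2 * k)" "k \<ge> 1"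
    "x = alt_word s t (2 * k)" "y = alt_word t s (2 * k)"
proof -
  from assms(3) obtain s t m where *: "s \<in> S" "t \<in> S" "s \<noteq> t" "M s t = enat m"
    "x = alt_word s t m" "y = alt_word t s m" by (auto simp: artin_relations_def)
  moreover from this obtain k where "M s t = enat (2 * k)" "k \<ge> 1"
    using even_labelE[OF assms(1,2), of s t] by auto
  ultimately show thesis using that by auto
qed

text \<open>As labels are at least 2, each side of a braid relation contains both generators, so the
  relations over \<open>T\<close> are those of the subgraph. The retracts are thereby Artin groups
  to which an induction on \<open>S\<close> applies.\<close>

lemma artin_group_subset:
  assumes "coxeter_matrix S M" "even_type S M" "T \<subseteq> S"
  shows "presented_group T (artin_relations S M) = artin_group T M"
  unfolding artin_group_def
proof (rule presented_group_cong)
  fix x y assume w: "x \<in> words T" "y \<in> words T"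
  show "(x, y) \<in> artin_relations S M \<longleftrightarrow> (x, y) \<in> artin_relations T M"
  proof
    assume "(x, y) \<in> artin_relations S M"
    then obtain s t k where "s \<noteq> t" "M s t = enat (2 * k)" "k \<ge> 1"
      "x = alt_word s t (2 * k)" "y = alt_word t s (2 * k)"
      using artin_relationsE[OF assms(1,2)] by metis
    moreover from this have "s \<in> T" "t \<in> T" using w(1) by (simp_all add: alt_word_words)
    ultimately show "(x, y) \<in> artin_relations T M"
      unfolding artin_relations_def by blast
  qed (use assms(3) in \<open>auto simp: artin_relations_def\<close>)
qed

lemma restrict_alt_word:
  "restrict_word T (alt_word a b (2 * k)) =
    (if a \<in> T \<and> b \<in> T then alt_word a b (2 * k)
     else if a \<in> T then replicate k (a, True)
     else if b \<in> T then replicate k (b, True) else [])"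
  by (induction k) auto

text \<open>Evenness makes both sides of a braid relation restrict to the same word.\<close>

lemma retractable_artin_relations:
  assumes "coxeter_matrix S M" "even_type S M" "T \<subseteq> S"
  shows "retractable S (artin_relations S M) T"
  unfolding retractable_def
proof (intro conjI ballI, rule assms(3), clarify)
  fix x y assume xy: "(x, y) \<in> artin_relations S M"
  from artin_relationsE[OF assms(1,2) this] obtain s t k where st: "s \<noteq> t" "k \<ge> 1"
    "x = alt_word s t (2 * k)" "y = alt_word t s (2 * k)" by metis
  show "(restrict_word T x, restrict_word T y) \<in> word_eq T (artin_relations S M)"
  proof (cases "s \<in> T \<and> t \<in> T")
    case True
    then have "x \<in> words T" "y \<in> words T" using st by (auto simp: alt_word_words)
    then show ?thesis
      using word_eq.rel[OF xy, of T "[]" "[]"] by (simp add: restrict_word_id)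
  next
    case False
    then show ?thesis using st by (auto simp: restrict_alt_word intro!: word_eq.refl)
  qed
qed

section \<open>Finite labels and the assembly of the proof\<close>

lemma FC_type_label_two:
  assumes M: "coxeter_matrix S M" "even_type S M" "FC_type S M"
    and fin: "\<And>s t. s \<in> S \<Longrightarrow> t \<in> S \<Longrightarrow> M s t \<noteq> \<infinity>"
    and abc: "a \<in> S" "b \<in> S" "c \<in> S" "a \<noteq> b" "b \<noteq> c" "a \<noteq> c"
    and ab: "M a b \<noteq> 2"
  shows "M b c = 2"
proof (rule ccontr)
  assume bc: "M b c \<noteq> 2"
  obtain k where k: "M a b = enat (2 * k)" "k \<ge> 1" using even_labelE[OF M(1,2)] abc fin by metis
  obtain l where l: "M b c = enat (2 * l)" "l \<ge> 1" using even_labelE[OF M(1,2)] abc fin by metis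
  obtain m where m: "M a c = enat (2 * m)" using even_labelE[OF M(1,2)] abc fin by metis
  have "k \<noteq> 1" "l \<noteq> 1" using ab bc k l by (auto simp: numeral_eq_enat)
  then have "k \<ge> 2" "l \<ge> 2" using k l by auto
  moreover have "coxeter_matrix {a, b, c} M" using M(1) abc by (auto intro: coxeter_matrix_subset)
  ultimately have "infinite (carrier (coxeter_group {a, b, c} M))"
    using infinite_coxeter_group[OF abc(4,5,6) _ k(1) _ l(1) _ m] by blast
  moreover have "spherical_type {a, b, c} M"
    using M(3) abc fin unfolding FC_type_def by (metis (no_types, lifting) empty_subsetI insert_subset subsetD)
  ultimately show False by (simp add: spherical_type_def)
qed

lemma commute_label_two:
  assumes "s \<in> S" "t \<in> S" "s \<noteq> t" "M s t = 2"
  shows "([(s, True), (t, True)], [(t, True), (s, True)]) \<in> word_eq S (artin_relations S M)"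
proof -
  have "(alt_word s t 2, alt_word t s 2) \<in> artin_relations S M"
    using assms by (auto simp: artin_relations_def numeral_eq_enat)
  from word_eq.rel[OF this, of S "[]" "[]"] show ?thesis
    using assms by (simp add: numeral_2_eq_2)
qed

lemma residually_finite_artin_group_dihedral:
  assumes "coxeter_matrix {s, t} M" "s \<noteq> t" "M s t = enat (2 * k)" "k \<ge> 1"
  shows "residually_finite (artin_group {s, t} M)"
proof -
  let ?R = "{(alt_word s t (2 * k), alt_word t s (2 * k)), (alt_word t s (2 * k), alt_word s t (2 * k))}"
  have "M s t = M t s" using assms(1,2) unfolding coxeter_matrix_def by blast
  then have ts: "M t s = enat (2 * k)" using assms(3) by simp
  have "artin_relations {s, t} M = ?R"
  proof
    show "artin_relations {s, t} M \<subseteq> ?R"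
    proof
      fix p assume "p \<in> artin_relations {s, t} M"
      then obtain a b m where "p = (alt_word a b m, alt_word b a m)" "a \<in> {s, t}" "b \<in> {s, t}" "a \<noteq> b"
        "M a b = enat m" unfolding artin_relations_def by blast
      then show "p \<in> ?R" using ts assms(3) by auto
    qed
    show "?R \<subseteq> artin_relations {s, t} M"
      using ts assms(2,3) unfolding artin_relations_def by blast
  qed
  then show ?thesis
    unfolding artin_group_def using assms(2,4) by (intro residually_finite_dihedral) auto
qed

lemma residually_finite_artin_group_singleton: "residually_finite (artin_group {s} M)"
  unfolding artin_group_def
  by (rule residually_finite_cyclic[of _ _ 0]) (auto simp: artin_relations_def intro: word_eq.refl)

lemma residually_finite_artin_group_empty: "residually_finite (artin_group {} M)"
  unfolding artin_group_def
proof (rule residually_finite_presented_groupI)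
  fix w :: "'a word" assume "w \<in> words {}" "(w, []) \<notin> word_eq {} (artin_relations {} M)"
  then show "\<exists>N. finite_index_normal N (presented_group {} (artin_relations {} M)) \<and>
      word_class {} (artin_relations {} M) w \<notin> N"
    by (cases w) (auto intro: word_eq.refl)
qed

theorem theorem4p2:
  fixes S :: "'a set" and M :: "'a \<Rightarrow> 'a \<Rightarrow> enat"
  assumes "finite S"
    and "coxeter_matrix S M"
    and "even_type S M"
    and "FC_type S M"
  shows "residually_finite (artin_group S M)"
  using assms
proof (induction S rule: finite_psubset_induct)
  case (psubset S)
  note M = psubset.prems
  let ?R = "artin_relations S M"
  have IH: "residually_finite (presented_group T ?R)" if "T \<subset> S" for T
    using psubset.IH[OF that] that M
    by (auto simp: artin_group_subset coxeter_matrix_subset even_type_subset FC_type_subset)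
  have ret: "retractable S ?R T" if "T \<subseteq> S" for T
    using retractable_artin_relations[OF M(1,2) that] .
  have M_sym: "M s t = M t s" if "s \<in> S" "t \<in> S" for s t
    using M(1) that by (cases "s = t") (auto simp: coxeter_matrix_def)
  show ?case
  proof (cases "\<exists>s\<in>S. \<exists>t\<in>S. s \<noteq> t \<and> M s t = \<infinity>")
    case True
    then obtain s t where st: "s \<in> S" "t \<in> S" "s \<noteq> t" "M s t = \<infinity>" by blast
    show ?thesis
      unfolding artin_group_def
    proof (rule residually_finite_amalgam[OF st(1-3)])
      fix x y assume "(x, y) \<in> ?R"
      from artin_relationsE[OF M(1,2) this] obtain a b k where
        ab: "a \<in> S" "b \<in> S" "M a b = enat (2 * k)" "k \<ge> 1"
        "x = alt_word a b (2 * k)" "y = alt_word b a (2 * k)" by metis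
      \<comment> \<open>A relation involving both \<open>s\<close> and \<open>t\<close> would come
        from a finite label of this pair.\<close>
      have "\<not> (s \<in> {a, b} \<and> t \<in> {a, b})" using ab st M_sym[of s t] by auto
      then show "x \<in> words (S - {s}) \<and> y \<in> words (S - {s}) \<or> x \<in> words (S - {t}) \<and> y \<in> words (S - {t})"
        using ab by (auto simp: alt_word_words)
    qed (use st in \<open>auto intro: ret IH\<close>)
  next
    case False
    then have fin: "M s t \<noteq> \<infinity>" if "s \<in> S" "t \<in> S" for s t
      using that M(1) by (cases "s = t") (auto simp: coxeter_matrix_def)
    show ?thesis
    proof (cases "S = {}")
      case True
      then show ?thesis by (simp add: residually_finite_artin_group_empty)
    next
      case False
      then obtain s where s: "s \<in> S" by blast
      \<comment> \<open>\<open>T\<close> consists of \<open>s\<close> and, if there is one, the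
        vertex whose label with \<open>s\<close> differs from 2. Applying
        \<open>FC_type_label_two\<close> from both ends of that edge shows that \<open>T\<close>
        commutes with the rest and splits off.\<close>
      obtain T where T: "T \<subseteq> S" "s \<in> T" "residually_finite (artin_group T M)"
        "\<And>t u. t \<in> T \<Longrightarrow> u \<in> S - T \<Longrightarrow> M t u = 2"
      proof (cases "\<exists>t\<in>S. t \<noteq> s \<and> M s t \<noteq> 2")
        case True
        then obtain t where t: "t \<in> S" "t \<noteq> s" "M s t \<noteq> 2" by blast
        obtain k where k: "M s t = enat (2 * k)" "k \<ge> 1"
          using even_labelE[OF M(1,2) s t(1)] t(2) fin s t(1) by metis
        show thesis
        proof (rule that[of "{s, t}"])
          show "residually_finite (artin_group {s, t} M)"
            using residually_finite_artin_group_dihedral[where s = s and t = t and M = M, OF _ _ k] t(2) s t(1)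
              coxeter_matrix_subset[OF M(1), of "{s, t}"] by auto
          show "M v u = 2" if "v \<in> {s, t}" "u \<in> S - {s, t}" for v u
            using that FC_type_label_two[OF M fin, of s t u] FC_type_label_two[OF M fin, of t s u]
              s t M_sym[OF s t(1)] by auto
        qed (use s t in auto)
      next
        case False
        show thesis
        proof (rule that[of "{s}"])
          show "M v u = 2" if "v \<in> {s}" "u \<in> S - {s}" for v u using that False by auto
        qed (use s residually_finite_artin_group_singleton in auto)
      qed
      show ?thesis
        unfolding artin_group_def
      proof (rule residually_finite_product[of S T "S - T"])
        show "residually_finite (presented_group T ?R)"
          using T(1,3) M by (simp add: artin_group_subset)
        show "([(t, True), (u, True)], [(u, True), (t, True)]) \<in> word_eq S ?R"
          if "t \<in> T" "u \<in> S - T" for t u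
          using that T(1,4) by (intro commute_label_two) auto
      qed (use T s in \<open>auto intro!: ret IH\<close>)
    qed
  qed
qed

end
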